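(* Let $T_n$ denote the random tree on $n$ vertices generated by the Barabási–Albert preferential attachment model with $m_0=m=1$ (linear preferential attachment). Then $$\lim_{n\to\infty}\mathbb{P}\big(\mathcal{E}(T_n) < n\big)=1,$$ i.e. with probability tending to $1$ as $n\to\infty$, $T_n$ is hypoenergetic.
   Context: For a finite simple graph $G$ with adjacency matrix $A(G)$ having eigenvalues $\lambda_1,\dots,\lambda_n$, the energy of $G$ is $\mathcal{E}(G)=\sum_{i=1}^n|\lambda_i|$. A graph on $n$ vertices is called hypoenergetic if $\mathcal{E}(G)<n$. The Barabási–Albert tree is built as follows: start with a single vertex (the second vertex is joined to it); thereafter, at each step a new vertex is added together with exactly one edge joining it to an already existing vertex $i$, chosen with probability $d_i/\sum_j d_j$, where $d_j$ is the current degree of vertex $j$. After $n$ vertices have been added, the resulting random tree is $T_n$. *)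

theory Defs
  imports "HOL-Probability.Probability" "Jordan_Normal_Form.Char_Poly"
begin

text \<open>A tree on vertices 0..n-1 is encoded by its parent list ps of length n-1:
  vertex k (1 <= k < n) is joined by an edge to vertex ps ! (k-1) < k.\<close>

definition adj_matrix :: "nat \<Rightarrow> nat list \<Rightarrow> complex mat" where
  "adj_matrix n ps = mat n n (\<lambda>(i,j).
      if (1 \<le> i \<and> j = ps ! (i - 1)) \<or> (1 \<le> j \<and> i = ps ! (j - 1)) then 1 else 0)"

definition energy :: "complex mat \<Rightarrow> real" where
  "energy A = sum_mset (image_mset cmod (proots (char_poly A)))"

definition hypoenergetic :: "nat \<Rightarrow> nat list \<Rightarrow> bool" where
  "hypoenergetic n ps \<longleftrightarrow> energy (adj_matrix n ps) < real n"

definition tdeg :: "nat \<Rightarrow> nat list \<Rightarrow> nat \<Rightarrow> nat" where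
  "tdeg k ps i = card {j. 1 \<le> j \<and> j < k \<and> ps ! (j - 1) = i} + (if 1 \<le> i \<and> i < k then 1 else 0)"

definition pref_choice :: "nat \<Rightarrow> nat list \<Rightarrow> nat pmf" where
  "pref_choice k ps = embed_pmf (\<lambda>i. if i < k
      then real (tdeg k ps i) / real (\<Sum>j<k. tdeg k ps j) else 0)"

fun ba_tree :: "nat \<Rightarrow> nat list pmf" where
  "ba_tree 0 = return_pmf []"
| "ba_tree (Suc 0) = return_pmf []"
| "ba_tree (Suc (Suc 0)) = return_pmf [0]"
| "ba_tree (Suc (Suc (Suc k))) =
     bind_pmf (ba_tree (Suc (Suc k))) (\<lambda>ps.
       map_pmf (\<lambda>i. ps @ [i]) (pref_choice (Suc (Suc k)) ps))"

end

theory Submission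
  imports Defs "Jordan_Normal_Form.Schur_Decomposition" "HOL-Real_Asymp.Real_Asymp"
begin

text \<open>
  By Schur triangularisation the energy of \<open>A\<close> equals the trace of \<open>A U\<close> for some unitary \<open>U\<close>. Splitting the
  edges of the tree into stars and applying Cauchy-Schwarz to the rows and columns of \<open>U\<close>, a star with \<open>c\<close> edges
  contributes at most \<open>2 sqrt c\<close>. Giving every edge to its upper end yields the bound \<open>\<Sum> 2 sqrt c\<^sub>v\<close> over the
  numbers \<open>c\<^sub>v\<close> of children, whose limiting value per vertex, about 1.006, is just too large. It drops below 1
  when each pendant path \<open>v - w - x\<close> is treated as one star with two edges instead of two stars with one edge.

  The number of vertices with \<open>k\<close> children and the number of pendant paths have one-step drifts that are linear in
  such counts, so a second moment recursion gives their limiting densities \<open>4 / ((k + 1) (k + 2) (k + 3))\<close>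
  and \<open>2 / 105\<close>; vertices with many children are controlled by a tangent line of the square root.
\<close>

subsection \<open>Energy as a trace against a unitary matrix\<close>

definition adjm :: "complex mat \<Rightarrow> complex mat" where
  "adjm A = map_mat cnj (transpose_mat A)"

lemma adjm_carrier [simp]: "A \<in> carrier_mat m n \<Longrightarrow> adjm A \<in> carrier_mat n m"
  by (simp add: adjm_def)

lemma adjm_index [simp]: "i < dim_col A \<Longrightarrow> j < dim_row A \<Longrightarrow> adjm A $$ (i, j) = cnj (A $$ (j, i))"
  by (simp add: adjm_def)

lemma adjm_dim [simp]: "dim_row (adjm A) = dim_col A" "dim_col (adjm A) = dim_row A"
  by (simp_all add: adjm_def)

lemma adjm_mult:
  assumes "A \<in> carrier_mat m n" "B \<in> carrier_mat n k"
  shows "adjm (A * B) = adjm B * adjm A"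
  using assms
  by (intro eq_matI) (auto simp: scalar_prod_def intro!: sum.cong)

lemma index_mult_mat_sum:
  fixes A B :: "'a :: semiring_0 mat"
  assumes "A \<in> carrier_mat m n" "B \<in> carrier_mat n k" "i < m" "j < k"
  shows "(A * B) $$ (i, j) = (\<Sum>l<n. A $$ (i, l) * B $$ (l, j))"
  using assms by (auto simp: scalar_prod_def lessThan_atLeast0 intro!: sum.cong)

lemma adjm_mult_self_index:
  assumes "W \<in> carrier_mat n n" "i < n" "j < n"
  shows "(adjm W * W) $$ (i, j) = (\<Sum>l<n. cnj (W $$ (l, i)) * W $$ (l, j))"
  using assms by (subst index_mult_mat_sum[of _ n n _ n]) auto

text \<open>Extend \<open>v\<close> to a basis, orthogonalise by Gram-Schmidt, which keeps the head
  of the list, and normalise. With \<open>v\<close> an eigenvector this supplies the change of basis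
  for one deflation step.\<close>

lemma unitary_completion:
  assumes v: "v \<in> carrier_vec n" and v0: "v \<noteq> 0\<^sub>v n" and n: "n \<noteq> 0"
  obtains W c where "W \<in> carrier_mat n n" "adjm W * W = 1\<^sub>m n" "col W 0 = c \<cdot>\<^sub>v v"
proof -
  define b where "b = basis_completion v"
  define ws where "ws = gram_schmidt n b"
  interpret cof_vec_space n "TYPE(complex)" .
  from basis_completion[OF v v0, folded b_def]
  have dist_b: "distinct b" and indep: "\<not> lin_dep (set b)" and b: "set b \<subseteq> carrier_vec n"
    and hdb: "hd b = v" and len_b: "length b = n" by auto
  from hdb len_b n obtain vs where bv: "b = v # vs" by (cases b) auto
  from gram_schmidt_result[OF b dist_b indep refl, folded ws_def]
  have ws: "set ws \<subseteq> carrier_vec n" "corthogonal ws" "length ws = n"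
    by (auto simp: len_b)
  from gram_schmidt_hd[OF v, of vs, folded bv] have hdws: "hd ws = v" unfolding ws_def .
  have wsc: "ws ! i \<in> carrier_vec n" if "i < n" for i using ws that by auto
  have ip: "ws ! i \<bullet>c ws ! j = (\<Sum>l<n. ws ! i $ l * cnj (ws ! j $ l))" if "i < n" "j < n" for i j
    using wsc[OF that(1)] wsc[OF that(2)]
    by (auto simp: scalar_prod_def lessThan_atLeast0 intro!: sum.cong)
  \<comment> \<open>The Gram-Schmidt vectors are orthogonal but not normalised; \<open>N i\<close>
    are their lengths, nonzero because \<open>corthogonal\<close> also demands nonvanishing
    self-products.\<close>
  define N where "N i = sqrt (\<Sum>l<n. (cmod (ws ! i $ l))\<^sup>2)" for i
  have N2: "of_real ((N i)\<^sup>2) = ws ! i \<bullet>c ws ! i" if "i < n" for i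
    unfolding ip[OF that that] by (simp add: N_def sum_nonneg of_real_sum complex_norm_square del: of_real_power)
  have Nnz: "N i \<noteq> 0" if "i < n" for i
    using N2[OF that] corthogonalD[OF ws(2), of i i] ws(3) that by auto
  define W where "W = mat n n (\<lambda>(l, i). ws ! i $ l / of_real (N i))"
  have W: "W \<in> carrier_mat n n" by (simp add: W_def)
  have "adjm W * W = 1\<^sub>m n"
  proof (rule eq_matI)
    fix i j assume "i < dim_row (1\<^sub>m n :: complex mat)" "j < dim_col (1\<^sub>m n :: complex mat)"
    hence ij: "i < n" "j < n" by auto
    have "(adjm W * W) $$ (i, j) = (\<Sum>l<n. cnj (W $$ (l, i)) * W $$ (l, j))"
      by (rule adjm_mult_self_index[OF W ij])
    also have "\<dots> = (\<Sum>l<n. ws ! j $ l * cnj (ws ! i $ l) / of_real (N i * N j))"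
      using ij by (intro sum.cong) (auto simp: W_def mult_ac)
    also have "\<dots> = (ws ! j \<bullet>c ws ! i) / of_real (N i * N j)"
      unfolding ip[OF ij(2) ij(1)] by (simp add: sum_divide_distrib)
    also have "\<dots> = 1\<^sub>m n $$ (i, j)"
    proof (cases "i = j")
      case True
      then show ?thesis using ij Nnz[OF ij(1)]
        by (simp add: N2[OF ij(2), symmetric] power2_eq_square)
    next
      case False
      then show ?thesis using ij corthogonalD[OF ws(2), of j i] ws(3) by simp
    qed
    finally show "(adjm W * W) $$ (i, j) = 1\<^sub>m n $$ (i, j)" .
  qed (use W in auto)
  moreover have "col W 0 = (1 / of_real (N 0)) \<cdot>\<^sub>v v"
  proof -
    have "ws ! 0 = v" using n hdws ws(3) by (metis hd_conv_nth length_0_conv)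
    then show ?thesis using n v by (intro eq_vecI) (auto simp: W_def)
  qed
  ultimately show thesis using W that by blast
qed

section \<open>Schur triangularisation by unitary deflation\<close>

lemma adjm_four_block:
  assumes "A \<in> carrier_mat n1 m1" "B \<in> carrier_mat n1 m2" "C \<in> carrier_mat n2 m1" "D \<in> carrier_mat n2 m2"
  shows "adjm (four_block_mat A B C D) = four_block_mat (adjm A) (adjm C) (adjm B) (adjm D)"
  using assms by (intro eq_matI) auto

lemma unitary_mult:
  assumes "P \<in> carrier_mat n n" "Q \<in> carrier_mat n n" "adjm P * P = 1\<^sub>m n" "adjm Q * Q = 1\<^sub>m n"
  shows "adjm (P * Q) * (P * Q) = 1\<^sub>m n"
proof -
  have "adjm (P * Q) * (P * Q) = adjm Q * (adjm P * P) * Q"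
    using assms(1,2) by (simp add: adjm_mult[of _ n n _ n] assoc_mult_mat[of _ n n _ n _ n] mult_carrier_mat[of _ n n _ n])
  then show ?thesis using assms by simp
qed

text \<open>Induction on the list of eigenvalues: with an eigenvector for \<open>e\<close> as first
  basis vector, the first column of the transformed matrix is \<open>e\<close> followed by zeros,
  and the remaining diagonal block has the other eigenvalues. Only the diagonal is recorded, since a
  trace sees nothing else.\<close>

theorem unitary_schur_diag:
  assumes "A \<in> carrier_mat n n" "char_poly A = (\<Prod>e\<leftarrow>es. [:- e, 1:])"
  shows "\<exists>P \<in> carrier_mat n n. adjm P * P = 1\<^sub>m n \<and> diag_mat (adjm P * A * P) = es"
  using assms
proof (induction es arbitrary: n A)
  case Nil
  with degree_monic_char_poly[of A n] show ?case
    by (intro bexI[of _ "1\<^sub>m n"]) (auto simp: diag_mat_def)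
next
  case (Cons e es n A)
  let ?n1 = "n - 1"
  from Cons have A: "A \<in> carrier_mat n n" by auto
  have cp: "char_poly A = [: -e, 1 :] * (\<Prod>e \<leftarrow> es. [:- e, 1:])" using Cons(3) by auto
  have mon: "monic (\<Prod>e\<leftarrow> es. [:- e, 1:])" by (rule monic_prod_list) auto
  have "degree (char_poly A) = Suc (degree (\<Prod>e\<leftarrow> es. [:- e, 1:]))" unfolding cp
    by (subst degree_mult_eq, insert mon, auto)
  with degree_monic_char_poly[OF A] have n: "n \<noteq> 0" by auto
  have "eigenvalue A e"
    unfolding eigenvalue_root_char_poly[OF A] cp by simp
  then obtain v where v: "v \<in> carrier_vec n" and v0: "v \<noteq> 0\<^sub>v n" and eig: "A *\<^sub>v v = e \<cdot>\<^sub>v v"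
    using A unfolding eigenvalue_def eigenvector_def by auto
  obtain W c where W: "W \<in> carrier_mat n n" and WW: "adjm W * W = 1\<^sub>m n"
    and c: "col W 0 = c \<cdot>\<^sub>v v"
    using unitary_completion[OF v v0 n] by blast
  have WW': "W * adjm W = 1\<^sub>m n" using mat_mult_left_right_inverse[OF _ W WW] W by auto
  define A' where "A' = adjm W * A * W"
  have A': "A' \<in> carrier_mat n n" unfolding A'_def using W A by auto
  have "similar_mat_wit A' A (adjm W) W"
    by (rule similar_mat_witI[of _ _ n], insert W A A' WW WW', auto simp: A'_def)
  hence A'A: "similar_mat A' A" unfolding similar_mat_def by blast
  have colAW: "col (A * W) 0 = e \<cdot>\<^sub>v col W 0"
  proof -
    have "col (A * W) 0 = A *\<^sub>v col W 0" using n W A by auto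
    also have "\<dots> = e \<cdot>\<^sub>v col W 0"
      unfolding c using A v by (simp add: mult_mat_vec eig smult_smult_assoc mult.commute)
    finally show ?thesis .
  qed
  have AW0: "(A * W) $$ (l, 0) = e * W $$ (l, 0)" if "l < n" for l
  proof -
    have "(A * W) $$ (l, 0) = col (A * W) 0 $ l" using that n A W by (intro index_col[symmetric]) auto
    then show ?thesis unfolding colAW using that n W by simp
  qed
  have A'0: "A' $$ (i, 0) = (if i = 0 then e else 0)" if i: "i < n" for i
  proof -
    have "A' $$ (i, 0) = (adjm W * (A * W)) $$ (i, 0)"
      unfolding A'_def using A W by (simp add: assoc_mult_mat[of _ n n _ n _ n])
    also have "\<dots> = (\<Sum>l<n. adjm W $$ (i, l) * (A * W) $$ (l, 0))"
      using A W i n by (intro index_mult_mat_sum) auto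
    also have "\<dots> = e * (\<Sum>l<n. adjm W $$ (i, l) * W $$ (l, 0))"
      by (simp add: AW0 sum_distrib_left mult_ac)
    also have "(\<Sum>l<n. adjm W $$ (i, l) * W $$ (l, 0)) = (adjm W * W) $$ (i, 0)"
      using A W i n by (intro index_mult_mat_sum[symmetric]) auto
    finally show ?thesis using i n by (simp add: WW)
  qed
  obtain A1 A2 A0 A3 where splitA': "split_block A' 1 1 = (A1,A2,A0,A3)"
    by (cases "split_block A' 1 1", auto)
  from A' n have "dim_row A' = 1 + ?n1" "dim_col A' = 1 + ?n1" by auto
  from split_block[OF splitA' this] have A2: "A2 \<in> carrier_mat 1 ?n1"
    and A3: "A3 \<in> carrier_mat ?n1 ?n1"
    and A'block: "A' = four_block_mat A1 A2 A0 A3" by auto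
  have A1id: "A1 = mat 1 1 (\<lambda> _. e)"
    using splitA'[unfolded split_block_def Let_def] A'0[of 0] A' n by auto
  have A1: "A1 \<in> carrier_mat 1 1" unfolding A1id by auto
  have A0id: "A0 = 0\<^sub>m ?n1 1"
    using splitA'[unfolded split_block_def Let_def] A'0 A' by auto
  have A0: "A0 \<in> carrier_mat ?n1 1" unfolding A0id by auto
  from cp char_poly_similar[OF A'A]
  have cp: "char_poly A' = [: -e,1 :] * (\<Prod> e \<leftarrow> es. [:- e, 1:])" by simp
  also have "char_poly A' = char_poly A1 * char_poly A3"
    unfolding A'block A0id by (rule char_poly_four_block_zeros_col[OF A1 A2 A3])
  also have "char_poly A1 = [: -e,1 :]"
    by (simp add: A1id char_poly_defs det_def sign_def)
  finally have "char_poly A3 = (\<Prod> e \<leftarrow> es. [:- e, 1:])"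
    by (metis mult_cancel_left pCons_eq_0_iff zero_neq_one)
  from Cons.IH[OF A3 this] obtain P' where P': "P' \<in> carrier_mat ?n1 ?n1"
    and PP': "adjm P' * P' = 1\<^sub>m ?n1" and diag': "diag_mat (adjm P' * A3 * P') = es" by blast
  \<comment> \<open>\<open>F\<close> applies the unitary of the smaller block to all coordinates but
    the first, so the entry \<open>e\<close> stays in the corner and \<open>W * F\<close> is the
    required unitary.\<close>
  define F where "F = four_block_mat (1\<^sub>m 1) (0\<^sub>m 1 ?n1) (0\<^sub>m ?n1 1) P'"
  have F: "F \<in> carrier_mat n n" unfolding F_def using P' n
    by (metis One_nat_def Suc_pred four_block_carrier_mat gr0I one_carrier_mat plus_1_eq_Suc)
  have adj1: "adjm (1\<^sub>m 1) = 1\<^sub>m 1" "adjm (0\<^sub>m 1 ?n1) = 0\<^sub>m ?n1 1" "adjm (0\<^sub>m ?n1 1) = 0\<^sub>m 1 ?n1"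
    by (auto intro!: eq_matI)
  have adjF: "adjm F = four_block_mat (1\<^sub>m 1) (0\<^sub>m 1 ?n1) (0\<^sub>m ?n1 1) (adjm P')"
    unfolding F_def by (subst adjm_four_block[where ?n1.0=1 and ?m1.0=1 and ?n2.0="?n1" and ?m2.0="?n1"])
      (use P' in \<open>auto simp: adj1\<close>)
  have FF: "adjm F * F = 1\<^sub>m n"
    unfolding adjF unfolding F_def
    by (subst mult_four_block_mat[where ?nr1.0=1 and ?n1.0=1 and ?n2.0="?n1" and ?nr2.0="?n1" and ?nc1.0=1 and ?nc2.0="?n1"])
      (use P' PP' n in auto)
  have blk: "adjm F * A' * F = four_block_mat A1 (A2 * P') (0\<^sub>m ?n1 1) (adjm P' * A3 * P')"
    unfolding adjF unfolding F_def A'block A0id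
    apply (subst mult_four_block_mat[where ?nr1.0=1 and ?n1.0=1 and ?n2.0="?n1" and ?nr2.0="?n1" and ?nc1.0=1 and ?nc2.0="?n1"])
    using P' A1 A2 A3 apply auto[8]
    apply (subst mult_four_block_mat[where ?nr1.0=1 and ?n1.0=1 and ?n2.0="?n1" and ?nr2.0="?n1" and ?nc1.0=1 and ?nc2.0="?n1"])
    using P' A1 A2 A3 by (auto simp: mult_carrier_mat[of _ "n - Suc 0" "n - Suc 0" _ "n - Suc 0"])
  have "adjm (W * F) * A * (W * F) = adjm F * A' * F"
    unfolding A'_def using W A F by (simp add: adjm_mult[of _ n n _ n] assoc_mult_mat[of _ n n _ n _ n] mult_carrier_mat[of _ n n _ n])
  moreover have "diag_mat (adjm F * A' * F) = e # es"
  proof -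
    have D: "adjm P' * A3 * P' \<in> carrier_mat ?n1 ?n1" using P' A3 by (intro mult_carrier_mat) auto
    show ?thesis unfolding blk diag_four_block_mat[OF A1 D] diag' by (simp add: A1id diag_mat_def)
  qed
  ultimately show ?case
    using unitary_mult[OF W F WW FF] W F by (intro bexI[of _ "W * F"]) auto
qed

section \<open>The energy as a trace\<close>

lemma proots_prod_linear: "proots (\<Prod>e\<leftarrow>es. [:- e, 1:]) = mset (es :: complex list)"
proof (induction es)
  case (Cons e es)
  have "(\<Prod>e\<leftarrow>es. [:- e, 1:]) \<noteq> 0" by (auto simp: prod_list_zero_iff)
  then show ?case using Cons by (simp add: proots_mult del: mult_pCons_left)
qed simp

text \<open>Rotate each eigenvalue to its modulus by a phase \<open>d k\<close>. With
  \<open>D\<close> the diagonal matrix of the phases, the energy is the trace of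
  \<open>D P* A P\<close>, hence of \<open>A\<close> times the unitary \<open>P D P*\<close>. Only
  the unit lengths of rows and columns are kept, as Cauchy-Schwarz asks for no more.\<close>

theorem energy_eq_trace:
  assumes A: "A \<in> carrier_mat n n"
  obtains U where "\<And>i. i < n \<Longrightarrow> (\<Sum>j<n. (cmod (U i j))\<^sup>2) = 1" "\<And>j. j < n \<Longrightarrow> (\<Sum>i<n. (cmod (U i j))\<^sup>2) = 1"
    "complex_of_real (energy A) = (\<Sum>i<n. \<Sum>j<n. A $$ (i, j) * U i j)"
proof -
  obtain es where es: "char_poly A = (\<Prod>e\<leftarrow>es. [:- e, 1:])" and len: "length es = n"
    using char_poly_factorized[OF A] by auto
  have "proots (char_poly A) = mset es"
    unfolding es by (rule proots_prod_linear)
  hence "energy A = sum_list (map cmod es)"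
    unfolding energy_def by (metis mset_map sum_mset_sum_list)
  hence en: "energy A = (\<Sum>k<n. cmod (es ! k))"
    by (simp add: sum_list_sum_nth len lessThan_atLeast0)
  obtain P where P: "P \<in> carrier_mat n n" and PP: "adjm P * P = 1\<^sub>m n"
    and diag: "diag_mat (adjm P * A * P) = es"
    using unitary_schur_diag[OF A es] by blast
  have PP': "P * adjm P = 1\<^sub>m n" using mat_mult_left_right_inverse[OF _ P PP] P by auto
  have col: "(\<Sum>l<n. cnj (P $$ (l, i)) * P $$ (l, j)) = (if i = j then 1 else 0)" if "i < n" "j < n" for i j
    using adjm_mult_self_index[OF P that] PP that by simp
  have row: "(\<Sum>l<n. P $$ (i, l) * cnj (P $$ (j, l))) = (if i = j then 1 else 0)" if "i < n" "j < n" for i j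
    using index_mult_mat_sum[OF P adjm_carrier[OF P] that] PP' that P by simp
  \<comment> \<open>The value 1 at a zero eigenvalue keeps every phase of modulus 1;
    \<open>sgn\<close> alone would give 0 there and destroy unitarity.\<close>
  define d where "d k = (if es ! k = 0 then 1 else cnj (sgn (es ! k)))" for k
  have d1: "d k * cnj (d k) = 1" for k
    unfolding complex_norm_square[symmetric] by (simp add: d_def norm_sgn)
  have de: "d k * es ! k = of_real (cmod (es ! k))" for k
  proof (cases "es ! k = 0")
    case False
    then have "cnj (es ! k) * es ! k = of_real (cmod (es ! k)) * of_real (cmod (es ! k))"
      by (metis complex_norm_square mult.commute power2_eq_square of_real_mult)
    with False show ?thesis by (simp add: d_def sgn_eq field_simps)
  qed (simp add: d_def)
  \<comment> \<open>This is the entry \<open>(j, i)\<close> of \<open>P D P*\<close>; the transposed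
    indexing turns the trace into an entrywise sum.\<close>
  define U where "U i j = (\<Sum>k<n. d k * (cnj (P $$ (i, k)) * P $$ (j, k)))" for i j
  have sq: "of_real (\<Sum>j<n. (cmod (f j))\<^sup>2) = (\<Sum>j<n. f j * cnj (f j))" for f
    by (simp only: of_real_sum complex_norm_square)
  show thesis
  proof (rule that[of U])
    fix i assume i: "i < n"
    have "of_real (\<Sum>j<n. (cmod (U i j))\<^sup>2) =
      (\<Sum>j<n. \<Sum>k<n. \<Sum>m<n. (d k * cnj (P $$ (i, k)) * cnj (d m) * P $$ (i, m)) * (cnj (P $$ (j, m)) * P $$ (j, k)))"
      unfolding sq U_def by (simp add: sum_product mult_ac)
    also have "\<dots> = (\<Sum>k<n. \<Sum>j<n. \<Sum>m<n. (d k * cnj (P $$ (i, k)) * cnj (d m) * P $$ (i, m)) * (cnj (P $$ (j, m)) * P $$ (j, k)))"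
      by (rule sum.swap)
    also have "\<dots> = (\<Sum>k<n. \<Sum>m<n. \<Sum>j<n. (d k * cnj (P $$ (i, k)) * cnj (d m) * P $$ (i, m)) * (cnj (P $$ (j, m)) * P $$ (j, k)))"
      by (intro sum.cong refl sum.swap)
    \<comment> \<open>The sum over \<open>j\<close> is an inner product of two columns of
      \<open>P\<close>, so only \<open>m = k\<close> survives.\<close>
    also have "\<dots> = (\<Sum>k<n. \<Sum>m<n. if m = k then d k * cnj (P $$ (i, k)) * cnj (d m) * P $$ (i, m) else 0)"
      by (intro sum.cong refl) (simp add: sum_distrib_left[symmetric] col)
    also have "\<dots> = (\<Sum>k<n. (d k * cnj (d k)) * (P $$ (i, k) * cnj (P $$ (i, k))))"
      by (intro sum.cong refl) (simp add: mult_ac)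
    also have "\<dots> = 1" using row[OF i i] by (simp add: d1)
    finally show "(\<Sum>j<n. (cmod (U i j))\<^sup>2) = 1" by (simp only: of_real_eq_1_iff)
  next
    fix j assume j: "j < n"
    have "of_real (\<Sum>i<n. (cmod (U i j))\<^sup>2) =
      (\<Sum>i<n. \<Sum>k<n. \<Sum>m<n. (d k * P $$ (j, k) * cnj (d m) * cnj (P $$ (j, m))) * (cnj (P $$ (i, k)) * P $$ (i, m)))"
      unfolding sq U_def by (simp add: sum_product mult_ac)
    also have "\<dots> = (\<Sum>k<n. \<Sum>i<n. \<Sum>m<n. (d k * P $$ (j, k) * cnj (d m) * cnj (P $$ (j, m))) * (cnj (P $$ (i, k)) * P $$ (i, m)))"
      by (rule sum.swap)
    also have "\<dots> = (\<Sum>k<n. \<Sum>m<n. \<Sum>i<n. (d k * P $$ (j, k) * cnj (d m) * cnj (P $$ (j, m))) * (cnj (P $$ (i, k)) * P $$ (i, m)))"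
      by (intro sum.cong refl sum.swap)
    also have "\<dots> = (\<Sum>k<n. \<Sum>m<n. if k = m then d k * P $$ (j, k) * cnj (d m) * cnj (P $$ (j, m)) else 0)"
      by (intro sum.cong refl) (simp add: sum_distrib_left[symmetric] col)
    also have "\<dots> = (\<Sum>k<n. (d k * cnj (d k)) * (P $$ (j, k) * cnj (P $$ (j, k))))"
      by (intro sum.cong refl) (simp add: mult_ac)
    also have "\<dots> = 1" using row[OF j j] by (simp add: d1)
    finally show "(\<Sum>i<n. (cmod (U i j))\<^sup>2) = 1" by (simp only: of_real_eq_1_iff)
  next
    have ek: "es ! k = (\<Sum>i<n. \<Sum>j<n. cnj (P $$ (i, k)) * A $$ (i, j) * P $$ (j, k))" if k: "k < n" for k
    proof -
      have "es ! k = (adjm P * A * P) $$ (k, k)"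
        using arg_cong[OF diag, of "\<lambda>xs. xs ! k"] k P by (simp add: diag_mat_def del: index_mult_mat(1))
      also have "\<dots> = (\<Sum>j<n. (\<Sum>i<n. cnj (P $$ (i, k)) * A $$ (i, j)) * P $$ (j, k))"
        using P A k by (subst index_mult_mat_sum[of _ n n _ n]) (auto simp: index_mult_mat_sum[of _ n n _ n] simp del: index_mult_mat(1) intro!: sum.cong)
      also have "\<dots> = (\<Sum>i<n. \<Sum>j<n. cnj (P $$ (i, k)) * A $$ (i, j) * P $$ (j, k))"
        by (simp only: sum_distrib_right) (rule sum.swap)
      finally show ?thesis .
    qed
    have "complex_of_real (energy A) = (\<Sum>k<n. d k * es ! k)"
      by (simp add: en de)
    also have "\<dots> = (\<Sum>k<n. \<Sum>i<n. \<Sum>j<n. A $$ (i, j) * (d k * (cnj (P $$ (i, k)) * P $$ (j, k))))"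
      by (simp add: ek sum_distrib_left mult_ac)
    also have "\<dots> = (\<Sum>i<n. \<Sum>k<n. \<Sum>j<n. A $$ (i, j) * (d k * (cnj (P $$ (i, k)) * P $$ (j, k))))"
      by (rule sum.swap)
    also have "\<dots> = (\<Sum>i<n. \<Sum>j<n. \<Sum>k<n. A $$ (i, j) * (d k * (cnj (P $$ (i, k)) * P $$ (j, k))))"
      by (intro sum.cong refl sum.swap)
    also have "\<dots> = (\<Sum>i<n. \<Sum>j<n. A $$ (i, j) * U i j)"
      by (simp add: U_def sum_distrib_left)
    finally show "complex_of_real (energy A) = (\<Sum>i<n. \<Sum>j<n. A $$ (i, j) * U i j)" .
  qed
qed

subsection \<open>Star decomposition\<close>

definition parent :: "nat list \<Rightarrow> nat \<Rightarrow> nat" where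
  "parent ps j = ps ! (j - 1)"

definition children :: "nat \<Rightarrow> nat list \<Rightarrow> nat \<Rightarrow> nat set" where
  "children n ps v = {j \<in> {1..<n}. parent ps j = v}"

abbreviation nchild :: "nat \<Rightarrow> nat list \<Rightarrow> nat \<Rightarrow> nat" where
  "nchild n ps v \<equiv> card (children n ps v)"

definition tree_code :: "nat \<Rightarrow> nat list \<Rightarrow> bool" where
  "tree_code n ps \<longleftrightarrow> length ps = n - 1 \<and> (\<forall>j\<in>{1..<n}. parent ps j < j)"

text \<open>Pendant paths with two and three vertices, each represented by its leaf \<open>x\<close>. Excluding the root makes the
  degree of every vertex on the path one more than its number of children.\<close>

definition pendant2 :: "nat \<Rightarrow> nat list \<Rightarrow> nat set" where
  "pendant2 n ps = {x \<in> {1..<n}. nchild n ps x = 0 \<and> 1 \<le> parent ps x \<and> nchild n ps (parent ps x) = 1}"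

definition pendant3 :: "nat \<Rightarrow> nat list \<Rightarrow> nat set" where
  "pendant3 n ps = {x \<in> pendant2 n ps. 1 \<le> parent ps (parent ps x) \<and> nchild n ps (parent ps (parent ps x)) = 1}"

lemma finite_children [simp]: "finite (children n ps v)"
  by (simp add: children_def)

lemma finite_pendant [simp]: "finite (pendant2 n ps)" "finite (pendant3 n ps)"
  by (simp_all add: pendant2_def pendant3_def)

lemma only_child:
  assumes "nchild n ps v = 1" "j \<in> children n ps v"
  shows "children n ps v = {j}"
  using assms by (metis card_1_singletonE singletonD)

lemma tree_code_parent_less: "tree_code n ps \<Longrightarrow> j \<in> {1..<n} \<Longrightarrow> parent ps j < j"
  by (auto simp: tree_code_def)

lemma pendant2_facts:
  assumes "tree_code n ps" "x \<in> pendant2 n ps"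
  shows "x \<in> {1..<n}" "parent ps x \<in> {1..<n}" "children n ps x = {}" "children n ps (parent ps x) = {x}"
    "parent ps x < x"
proof -
  show x: "x \<in> {1..<n}" using assms by (simp add: pendant2_def)
  show px: "parent ps x < x" using tree_code_parent_less[OF assms(1) x] .
  show w: "parent ps x \<in> {1..<n}" using assms px x by (auto simp: pendant2_def)
  show "children n ps x = {}" using assms by (auto simp: pendant2_def)
  show "children n ps (parent ps x) = {x}"
    using assms x by (intro only_child) (auto simp: pendant2_def, auto simp: children_def)
qed

text \<open>Cauchy-Schwarz against the constant 1. It is applied to the entries of a unit row or
  column at the leaves of a star.\<close>

lemma sum_le_sqrt_card:
  fixes f :: "'a \<Rightarrow> real"
  assumes "(\<Sum>x\<in>S. (f x)\<^sup>2) \<le> 1"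
  shows "(\<Sum>x\<in>S. f x) \<le> sqrt (card S)"
proof -
  have "(\<Sum>x\<in>S. f x)\<^sup>2 \<le> (\<Sum>x\<in>S. (f x)\<^sup>2) * (\<Sum>x\<in>S. 1\<^sup>2)"
    using Cauchy_Schwarz_ineq_sum[of f "\<lambda>_. 1" S] by simp
  also have "\<dots> \<le> 1 * (\<Sum>x\<in>S. 1\<^sup>2)"
    using assms by (intro mult_right_mono) auto
  finally show ?thesis by (intro real_le_rsqrt) simp
qed

text \<open>The three vertices of the path have child sets \<open>{}\<close>, \<open>{x}\<close> and
  \<open>{parent ps x}\<close>. These identify the leaf, which is what makes different paths
  disjoint.\<close>

lemma pendant3_facts:
  assumes "tree_code n ps" "x \<in> pendant3 n ps"
  shows "x \<in> {1..<n}" "parent ps x \<in> {1..<n}" "parent ps (parent ps x) \<in> {1..<n}"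
    "children n ps x = {}" "children n ps (parent ps x) = {x}"
    "children n ps (parent ps (parent ps x)) = {parent ps x}"
    "parent ps x < x" "parent ps (parent ps x) < parent ps x"
proof -
  have p2: "x \<in> pendant2 n ps" using assms by (simp add: pendant3_def)
  note f = pendant2_facts[OF assms(1) p2]
  show "x \<in> {1..<n}" "parent ps x \<in> {1..<n}" "children n ps x = {}" "children n ps (parent ps x) = {x}"
    "parent ps x < x" by (fact f)+
  show ppx: "parent ps (parent ps x) < parent ps x" using tree_code_parent_less[OF assms(1) f(2)] .
  show "parent ps (parent ps x) \<in> {1..<n}" using assms ppx f(2) by (auto simp: pendant3_def)
  show "children n ps (parent ps (parent ps x)) = {parent ps x}"
    using assms f(2) by (intro only_child) (auto simp: pendant3_def, auto simp: children_def)
qed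

text \<open>An edge is named by its lower end \<open>j\<close>; grouping edges by upper end gives
  the stars.\<close>

lemma sum_over_parents:
  fixes f :: "nat \<Rightarrow> 'a :: comm_monoid_add"
  assumes "tree_code n ps"
  shows "(\<Sum>j\<in>{1..<n}. f j) = (\<Sum>v<n. \<Sum>j\<in>children n ps v. f j)"
proof -
  have "(\<Sum>v\<in>{..<n}. sum f {j\<in>{1..<n}. parent ps j = v}) = sum f {1..<n}"
    using tree_code_parent_less[OF assms] by (intro sum.group) force+
  then show ?thesis by (simp add: children_def)
qed

text \<open>Rooting each edge at its upper end cuts the tree into stars, of energy \<open>2 sqrt c\<close> each. Where the tree
  ends in a path \<open>v - w - x\<close> hanging below, the two single-edge stars at \<open>v\<close> and \<open>w\<close> are merged into one
  star with two edges centred at \<open>w\<close>.\<close>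

theorem energy_le_stars:
  assumes tc: "tree_code n ps"
  shows "energy (adj_matrix n ps) \<le> (\<Sum>v<n. 2 * sqrt (nchild n ps v)) - (4 - 2 * sqrt 2) * card (pendant3 n ps)"
proof -
  let ?A = "adj_matrix n ps"
  have A: "?A \<in> carrier_mat n n" by (simp add: adj_matrix_def)
  obtain U where row: "\<And>i. i < n \<Longrightarrow> (\<Sum>j<n. (cmod (U i j))\<^sup>2) = 1"
    and col: "\<And>j. j < n \<Longrightarrow> (\<Sum>i<n. (cmod (U i j))\<^sup>2) = 1"
    and en: "complex_of_real (energy ?A) = (\<Sum>i<n. \<Sum>j<n. ?A $$ (i, j) * U i j)"
    using energy_eq_trace[OF A] by blast
  let ?p = "parent ps"
  note pl = tree_code_parent_less[OF tc]
  \<comment> \<open>Parents have smaller labels, so the two alternatives in the adjacency matrix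
    exclude each other and the entry is a sum of two indicators.\<close>
  have Aij: "?A $$ (i, j) = (if i \<in> {1..<n} \<and> j = ?p i then 1 else 0) + (if j \<in> {1..<n} \<and> i = ?p j then 1 else 0)"
    if "i < n" "j < n" for i j
    using that pl[of i] pl[of j] by (auto simp: adj_matrix_def parent_def)
  have s1: "(\<Sum>i<n. \<Sum>j<n. (if i \<in> {1..<n} \<and> j = ?p i then 1 else 0) * U i j) = (\<Sum>i\<in>{1..<n}. U i (?p i))"
  proof -
    have "(\<Sum>j<n. (if i \<in> {1..<n} \<and> j = ?p i then 1 else 0) * U i j) = (if i \<in> {1..<n} then U i (?p i) else 0)"
      if "i < n" for i
      using pl[of i] by (auto simp: if_distrib[of "\<lambda>x. x * _"] cong: if_cong)
    then have "(\<Sum>i<n. \<Sum>j<n. (if i \<in> {1..<n} \<and> j = ?p i then 1 else 0) * U i j) =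
        (\<Sum>i<n. if i \<in> {1..<n} then U i (?p i) else 0)"
      by (intro sum.cong) auto
    also have "\<dots> = (\<Sum>i\<in>{1..<n}. U i (?p i))"
      by (subst sum.inter_restrict[symmetric]) (auto intro!: sum.cong)
    finally show ?thesis .
  qed
  have s2: "(\<Sum>i<n. \<Sum>j<n. (if j \<in> {1..<n} \<and> i = ?p j then 1 else 0) * U i j) = (\<Sum>j\<in>{1..<n}. U (?p j) j)"
  proof -
    have "(\<Sum>i<n. (if j \<in> {1..<n} \<and> i = ?p j then 1 else 0) * U i j) = (if j \<in> {1..<n} then U (?p j) j else 0)"
      if "j < n" for j
      using pl[of j] by (auto simp: if_distrib[of "\<lambda>x. x * _"] cong: if_cong)
    then have "(\<Sum>j<n. \<Sum>i<n. (if j \<in> {1..<n} \<and> i = ?p j then 1 else 0) * U i j) =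
        (\<Sum>j<n. if j \<in> {1..<n} then U (?p j) j else 0)"
      by (intro sum.cong) auto
    also have "\<dots> = (\<Sum>j\<in>{1..<n}. U (?p j) j)"
      by (subst sum.inter_restrict[symmetric]) (auto intro!: sum.cong)
    finally show ?thesis by (subst sum.swap)
  qed
  have "complex_of_real (energy ?A) =
      (\<Sum>i<n. \<Sum>j<n. (if i \<in> {1..<n} \<and> j = ?p i then 1 else 0) * U i j +
        (if j \<in> {1..<n} \<and> i = ?p j then 1 else 0) * U i j)"
    unfolding en by (intro sum.cong refl) (simp only: Aij distrib_right lessThan_iff)
  also have "\<dots> = (\<Sum>j\<in>{1..<n}. U j (?p j) + U (?p j) j)"
    by (simp only: sum.distrib s1 s2)
  finally have "complex_of_real (energy ?A) = (\<Sum>j\<in>{1..<n}. U j (?p j) + U (?p j) j)" .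
  then have "energy ?A \<le> cmod (\<Sum>j\<in>{1..<n}. U j (?p j) + U (?p j) j)"
    by (metis abs_ge_self norm_of_real)
  also have "\<dots> \<le> (\<Sum>j\<in>{1..<n}. cmod (U j (?p j)) + cmod (U (?p j) j))"
    by (rule order.trans[OF norm_sum]) (intro sum_mono norm_triangle_ineq)
  also have "\<dots> = (\<Sum>v<n. \<Sum>j\<in>children n ps v. cmod (U j (?p j)) + cmod (U (?p j) j))"
    by (rule sum_over_parents[OF tc])
  also have "\<dots> = (\<Sum>v<n. \<Sum>j\<in>children n ps v. cmod (U j v) + cmod (U v j))"
    by (intro sum.cong refl) (simp add: children_def)
  also have "\<dots> \<le> (\<Sum>v<n. 2 * sqrt (nchild n ps v)) - (4 - 2 * sqrt 2) * card (pendant3 n ps)"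
  proof -
    define g where "g v = (\<Sum>j\<in>children n ps v. cmod (U j v) + cmod (U v j))" for v
    let ?S = "pendant3 n ps"
    have colS: "(\<Sum>i\<in>S. cmod (U i v)) \<le> sqrt (card S)" if "S \<subseteq> {..<n}" "v < n" for S v
    proof (rule sum_le_sqrt_card)
      have "(\<Sum>i\<in>S. (cmod (U i v))\<^sup>2) \<le> (\<Sum>i<n. (cmod (U i v))\<^sup>2)"
        using that by (intro sum_mono2) auto
      then show "(\<Sum>i\<in>S. (cmod (U i v))\<^sup>2) \<le> 1" using col[OF that(2)] by simp
    qed
    have rowS: "(\<Sum>i\<in>S. cmod (U v i)) \<le> sqrt (card S)" if "S \<subseteq> {..<n}" "v < n" for S v
    proof (rule sum_le_sqrt_card)
      have "(\<Sum>i\<in>S. (cmod (U v i))\<^sup>2) \<le> (\<Sum>i<n. (cmod (U v i))\<^sup>2)"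
        using that by (intro sum_mono2) auto
      then show "(\<Sum>i\<in>S. (cmod (U v i))\<^sup>2) \<le> 1" using row[OF that(2)] by simp
    qed
    have g1: "g v \<le> 2 * sqrt (nchild n ps v)" if "v < n" for v
      using colS[of "children n ps v" v] rowS[of "children n ps v" v] that
      by (force simp: g_def sum.distrib children_def)
    \<comment> \<open>Both stars have a single edge and both edges meet at \<open>?p x\<close>, so
      two entries of one column and two of one row cover everything.\<close>
    have g2: "g (?p x) + g (?p (?p x)) \<le> 2 * sqrt 2" if "x \<in> ?S" for x
    proof -
      note f = pendant3_facts[OF tc that]
      have "g (?p x) + g (?p (?p x)) =
        (\<Sum>i\<in>{x, ?p (?p x)}. cmod (U i (?p x))) + (\<Sum>i\<in>{x, ?p (?p x)}. cmod (U (?p x) i))"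
        using f(7,8) by (simp add: g_def f(5,6))
      also have "\<dots> \<le> sqrt (card {x, ?p (?p x)}) + sqrt (card {x, ?p (?p x)})"
        using f(1-3) by (intro add_mono colS rowS) auto
      also have "\<dots> = 2 * sqrt 2" using f(7,8) by simp
      finally show ?thesis .
    qed
    let ?W = "?p ` ?S" and ?V = "(\<lambda>x. ?p (?p x)) ` ?S"
    have injW: "inj_on ?p ?S"
      by (rule inj_onI) (metis pendant3_facts(5)[OF tc] singleton_inject)
    have injV: "inj_on (\<lambda>x. ?p (?p x)) ?S"
      by (rule inj_onI) (metis pendant3_facts(5,6)[OF tc] singleton_inject)
    \<comment> \<open>If the middle vertex of one path were the top of another, equal child sets
      would make the leaf \<open>x\<close> the parent of \<open>y\<close>, but a leaf has no
      children.\<close>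
    have disj: "?W \<inter> ?V = {}"
    proof (rule ccontr)
      assume "?W \<inter> ?V \<noteq> {}"
      then obtain x y where xy: "x \<in> ?S" "y \<in> ?S" "?p x = ?p (?p y)" by auto
      have "{x} = {?p y}"
        unfolding pendant3_facts(5)[OF tc xy(1), symmetric] pendant3_facts(6)[OF tc xy(2), symmetric] xy(3) ..
      then have "x = ?p y" by simp
      then show False using pendant3_facts(4)[OF tc xy(1)] pendant3_facts(5)[OF tc xy(2)] by auto
    qed
    have sub: "?W \<union> ?V \<subseteq> {..<n}" using pendant3_facts(2,3)[OF tc] by force
    have split: "(\<Sum>v<n. h v) = (\<Sum>v\<in>{..<n} - (?W \<union> ?V). h v) + (\<Sum>x\<in>?S. h (?p x) + h (?p (?p x)))"
      for h :: "nat \<Rightarrow> real"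
    proof -
      have "(\<Sum>v<n. h v) = (\<Sum>v\<in>{..<n} - (?W \<union> ?V). h v) + (\<Sum>v\<in>?W \<union> ?V. h v)"
        by (rule sum.subset_diff[OF sub]) simp
      also have "(\<Sum>v\<in>?W \<union> ?V. h v) = (\<Sum>v\<in>?W. h v) + (\<Sum>v\<in>?V. h v)"
        by (rule sum.union_disjoint) (auto simp: disj)
      finally show ?thesis by (simp add: sum.reindex[OF injW] sum.reindex[OF injV] sum.distrib o_def)
    qed
    \<comment> \<open>Separately the two stars of a path would cost 2 each; together they cost
      \<open>2 * sqrt 2\<close>, which is the saving in the claim.\<close>
    have "(\<Sum>v<n. g v) \<le> (\<Sum>v\<in>{..<n} - (?W \<union> ?V). 2 * sqrt (nchild n ps v)) + (\<Sum>x\<in>?S. 2 * sqrt 2)"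
      unfolding split[of g] by (intro add_mono sum_mono g1 g2) auto
    also have "\<dots> = (\<Sum>v<n. 2 * sqrt (nchild n ps v)) - (4 - 2 * sqrt 2) * card ?S"
      unfolding split[of "\<lambda>v. 2 * sqrt (nchild n ps v)"]
      by (simp add: pendant3_facts(5,6)[OF tc] algebra_simps)
    finally show ?thesis by (simp add: g_def)
  qed
  finally show ?thesis .
qed

subsection \<open>Second moments along the attachment process\<close>

lemma tdeg_eq: "tdeg k ps i = nchild k ps i + (if i \<in> {1..<k} then 1 else 0)"
  by (auto simp: tdeg_def children_def parent_def intro!: arg_cong[of _ _ card])

lemma sum_nchild:
  assumes "tree_code n ps"
  shows "(\<Sum>v<n. nchild n ps v) = n - 1"
  using sum_over_parents[OF assms, of "\<lambda>_. 1 :: nat"] by simp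

lemma sum_tdeg:
  assumes "tree_code n ps"
  shows "(\<Sum>v<n. tdeg n ps v) = 2 * (n - 1)"
proof -
  have "(\<Sum>v<n. if v \<in> {1..<n} then 1 else 0) = n - (1::nat)"
    by (subst sum.inter_restrict[symmetric]) (auto simp: Int_absorb1 lessThan_atLeast0)
  then show ?thesis using sum_nchild[OF assms] by (simp add: tdeg_eq sum.distrib)
qed

definition attach_prob :: "nat \<Rightarrow> nat list \<Rightarrow> nat \<Rightarrow> real" where
  "attach_prob n ps i = real (tdeg n ps i) / (2 * (real n - 1))"

lemma attach_prob_nonneg: "n \<ge> 2 \<Longrightarrow> attach_prob n ps i \<ge> 0"
  by (simp add: attach_prob_def)

lemma sum_attach_prob:
  assumes "n \<ge> 2" "tree_code n ps"
  shows "(\<Sum>i<n. attach_prob n ps i) = 1"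
  using assms sum_tdeg[OF assms(2)]
  by (simp add: attach_prob_def sum_divide_distrib[symmetric] of_nat_diff flip: of_nat_sum)

text \<open>\<open>embed_pmf\<close> returns the given weights only once they are nonnegative with
  total 1; the total comes from the degree sum of a tree.\<close>

lemma pmf_pref_choice:
  assumes "n \<ge> 2" "tree_code n ps"
  shows "pmf (pref_choice n ps) i = (if i < n then attach_prob n ps i else 0)"
proof -
  let ?f = "\<lambda>i. if i < n then attach_prob n ps i else 0"
  have "(\<integral>\<^sup>+ i. ennreal (?f i) \<partial>count_space UNIV) = (\<Sum>i<n. ennreal (?f i))"
    by (intro nn_integral_count_space') auto
  also have "\<dots> = ennreal (\<Sum>i<n. attach_prob n ps i)"
    using assms by (subst sum_ennreal) (auto simp: attach_prob_nonneg)
  finally have "(\<integral>\<^sup>+ i. ennreal (?f i) \<partial>count_space UNIV) = 1"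
    using sum_attach_prob[OF assms] by simp
  then have "pmf (embed_pmf ?f) i = ?f i"
    using assms by (intro pmf_embed_pmf) (auto simp: attach_prob_nonneg)
  moreover have "pref_choice n ps = embed_pmf ?f"
    using assms unfolding pref_choice_def sum_tdeg[OF assms(2)]
    by (intro arg_cong[of _ _ embed_pmf] ext) (auto simp: attach_prob_def of_nat_diff)
  ultimately show ?thesis by simp
qed

lemma set_pref_choice:
  assumes "n \<ge> 2" "tree_code n ps"
  shows "set_pmf (pref_choice n ps) \<subseteq> {..<n}"
  using pmf_pref_choice[OF assms] by (auto simp: set_pmf_iff split: if_splits)

lemma parent_append:
  assumes "tree_code n ps"
  shows "j \<in> {1..<n} \<Longrightarrow> parent (ps @ [i]) j = parent ps j" "n \<ge> 1 \<Longrightarrow> parent (ps @ [i]) n = i"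
  using assms by (auto simp: parent_def tree_code_def nth_append)

lemma tree_code_append:
  assumes "tree_code n ps" "i < n"
  shows "tree_code (Suc n) (ps @ [i])"
  unfolding tree_code_def
proof (intro conjI ballI)
  show "length (ps @ [i]) = Suc n - 1" using assms by (auto simp: tree_code_def)
  fix j assume "j \<in> {1..<Suc n}"
  then show "parent (ps @ [i]) j < j"
    using parent_append[OF assms(1)] tree_code_parent_less[OF assms(1)] assms(2) by (cases "j = n") auto
qed

lemma ba_tree_Suc:
  assumes "n \<ge> 2"
  shows "ba_tree (Suc n) = bind_pmf (ba_tree n) (\<lambda>ps. map_pmf (\<lambda>i. ps @ [i]) (pref_choice n ps))"
proof -
  obtain k where "n = Suc (Suc k)" using assms by (metis Suc_le_D numeral_2_eq_2 Suc_le_mono)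
  then show ?thesis by simp
qed

lemma tree_code_ba_tree:
  assumes "n \<ge> 2" "ps \<in> set_pmf (ba_tree n)"
  shows "tree_code n ps"
  using assms
proof (induction n arbitrary: ps rule: dec_induct)
  case base
  then show ?case by (simp add: numeral_2_eq_2 tree_code_def parent_def)
next
  case (step n)
  from step.prems obtain qs i where "qs \<in> set_pmf (ba_tree n)" "i \<in> set_pmf (pref_choice n qs)" "ps = qs @ [i]"
    by (auto simp: ba_tree_Suc[OF step.hyps(1)])
  then show ?case using step.IH step.hyps set_pref_choice by (auto intro!: tree_code_append)
qed

text \<open>Finite support makes every real function of the tree integrable, so the moment
  computations carry no integrability conditions.\<close>

lemma finite_set_ba_tree:
  assumes "n \<ge> 2"
  shows "finite (set_pmf (ba_tree n))"
  using assms
proof (induction n rule: dec_induct)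
  case base
  then show ?case by (simp add: numeral_2_eq_2)
next
  case (step n)
  have "finite (set_pmf (pref_choice n ps))" if "ps \<in> set_pmf (ba_tree n)" for ps
    using set_pref_choice[OF step.hyps(1) tree_code_ba_tree[OF step.hyps(1) that]] finite_subset by blast
  then show ?case using step.IH by (simp add: ba_tree_Suc[OF step.hyps(1)])
qed

section \<open>One-step expectations and second moment bounds\<close>

abbreviation expect :: "nat \<Rightarrow> (nat list \<Rightarrow> real) \<Rightarrow> real" where
  "expect n f \<equiv> measure_pmf.expectation (ba_tree n) f"

lemma integrable_ba_tree [simp]:
  fixes f :: "nat list \<Rightarrow> real"
  shows "n \<ge> 2 \<Longrightarrow> integrable (measure_pmf (ba_tree n)) f"
  by (intro integrable_measure_pmf_finite finite_set_ba_tree)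

lemma expect_mono:
  assumes "n \<ge> 2" "\<And>ps. tree_code n ps \<Longrightarrow> f ps \<le> g ps"
  shows "expect n f \<le> expect n g"
  using assms by (intro integral_mono_AE) (auto simp: AE_measure_pmf_iff tree_code_ba_tree)

text \<open>The tower property: condition on the tree with \<open>n\<close> vertices and average
  over the host \<open>i\<close> of the new one.\<close>

lemma expect_Suc:
  assumes "n \<ge> 2"
  shows "expect (Suc n) f = expect n (\<lambda>ps. \<Sum>i<n. attach_prob n ps i * f (ps @ [i]))"
proof -
  have fin: "finite (set_pmf (pref_choice n ps))" if "ps \<in> set_pmf (ba_tree n)" for ps
    using set_pref_choice[OF assms tree_code_ba_tree[OF assms that]] finite_subset by blast
  have inner: "measure_pmf.expectation (map_pmf (\<lambda>i. ps @ [i]) (pref_choice n ps)) f =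
      (\<Sum>i<n. attach_prob n ps i * f (ps @ [i]))" if "ps \<in> set_pmf (ba_tree n)" for ps
    unfolding integral_map_pmf
    using set_pref_choice[OF assms tree_code_ba_tree[OF assms that]]
    by (subst integral_measure_pmf_real[of "{..<n}"])
      (auto simp: pmf_pref_choice[OF assms tree_code_ba_tree[OF assms that]] intro!: sum.cong)
  have "expect (Suc n) f = (\<Sum>ps\<in>set_pmf (ba_tree n). pmf (ba_tree n) ps *\<^sub>R
      measure_pmf.expectation (map_pmf (\<lambda>i. ps @ [i]) (pref_choice n ps)) f)"
    unfolding ba_tree_Suc[OF assms] using finite_set_ba_tree[OF assms] fin
    by (intro pmf_expectation_bind) auto
  also have "\<dots> = (\<Sum>ps\<in>set_pmf (ba_tree n). (\<Sum>i<n. attach_prob n ps i * f (ps @ [i])) * pmf (ba_tree n) ps)"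
    by (intro sum.cong refl) (simp add: inner mult.commute del: integral_map_pmf)
  also have "\<dots> = expect n (\<lambda>ps. \<Sum>i<n. attach_prob n ps i * f (ps @ [i]))"
    using finite_set_ba_tree[OF assms] by (intro integral_measure_pmf_real[symmetric]) auto
  finally show ?thesis .
qed

text \<open>Says that \<open>Y n\<close> is \<open>y * n\<close> up to an error of order
  \<open>sqrt n\<close> in mean square, so by Chebyshev \<open>Y n / n\<close> tends to
  \<open>y\<close> in probability. Centring at \<open>y * n\<close> instead of the mean makes the
  notion stable under linear combinations.\<close>

definition linear_growth :: "(nat \<Rightarrow> nat list \<Rightarrow> real) \<Rightarrow> real \<Rightarrow> bool" where
  "linear_growth Y y \<longleftrightarrow> (\<exists>C\<ge>0. \<forall>n\<ge>2. expect n (\<lambda>ps. (Y n ps - y * n)\<^sup>2) \<le> C * real n)"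

lemma sum_sq_le: "(a + b)\<^sup>2 \<le> 2 * a\<^sup>2 + 2 * b\<^sup>2" for a b :: real
  using sum_squares_ge_zero[of "a - b" 0] by (simp add: power2_eq_square algebra_simps)

lemma linear_growth_size: "linear_growth (\<lambda>n ps. c * real n) c"
  by (auto simp: linear_growth_def intro!: exI[of _ 0])

lemma linear_growth_add:
  assumes "linear_growth Y y" "linear_growth Z z"
  shows "linear_growth (\<lambda>n ps. Y n ps + Z n ps) (y + z)"
proof -
  obtain C D :: real where CD: "C \<ge> 0" "D \<ge> 0"
    "\<And>n. n \<ge> 2 \<Longrightarrow> expect n (\<lambda>ps. (Y n ps - y * n)\<^sup>2) \<le> C * n"
    "\<And>n. n \<ge> 2 \<Longrightarrow> expect n (\<lambda>ps. (Z n ps - z * n)\<^sup>2) \<le> D * n"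
    using assms unfolding linear_growth_def by metis
  have "expect n (\<lambda>ps. (Y n ps + Z n ps - (y + z) * n)\<^sup>2) \<le> (2 * C + 2 * D) * n" if n: "n \<ge> 2" for n
  proof -
    have "expect n (\<lambda>ps. (Y n ps + Z n ps - (y + z) * n)\<^sup>2) \<le>
        expect n (\<lambda>ps. 2 * (Y n ps - y * n)\<^sup>2 + 2 * (Z n ps - z * n)\<^sup>2)"
    proof (rule expect_mono[OF n])
      fix ps
      have "Y n ps + Z n ps - (y + z) * n = (Y n ps - y * n) + (Z n ps - z * n)"
        by (simp add: algebra_simps)
      then show "(Y n ps + Z n ps - (y + z) * n)\<^sup>2 \<le> 2 * (Y n ps - y * n)\<^sup>2 + 2 * (Z n ps - z * n)\<^sup>2"
        using sum_sq_le by metis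
    qed
    also have "\<dots> \<le> 2 * (C * n) + 2 * (D * n)"
      using CD(3)[OF n] CD(4)[OF n] n by simp
    finally show ?thesis by (simp add: algebra_simps)
  qed
  then show ?thesis using CD(1,2) unfolding linear_growth_def by (intro exI[of _ "2 * C + 2 * D"]) auto
qed

lemma linear_growth_cmult:
  assumes "linear_growth Y y"
  shows "linear_growth (\<lambda>n ps. c * Y n ps) (c * y)"
proof -
  obtain C :: real where C: "C \<ge> 0" "\<And>n. n \<ge> 2 \<Longrightarrow> expect n (\<lambda>ps. (Y n ps - y * n)\<^sup>2) \<le> C * n"
    using assms unfolding linear_growth_def by metis
  have "expect n (\<lambda>ps. (c * Y n ps - c * y * n)\<^sup>2) \<le> c\<^sup>2 * C * n" if n: "n \<ge> 2" for n
  proof -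
    have "(\<lambda>ps. (c * Y n ps - c * y * n)\<^sup>2) = (\<lambda>ps. c\<^sup>2 * (Y n ps - y * n)\<^sup>2)"
      by (auto simp: power_mult_distrib[symmetric] algebra_simps)
    then have "expect n (\<lambda>ps. (c * Y n ps - c * y * n)\<^sup>2) = c\<^sup>2 * expect n (\<lambda>ps. (Y n ps - y * n)\<^sup>2)"
      by simp
    also have "\<dots> \<le> c\<^sup>2 * (C * n)" by (intro mult_left_mono C n) auto
    finally show ?thesis by simp
  qed
  then show ?thesis using C(1) unfolding linear_growth_def by (intro exI[of _ "c\<^sup>2 * C"]) auto
qed

lemma linear_growth_sum:
  assumes "finite I" "\<And>k. k \<in> I \<Longrightarrow> linear_growth (Y k) (y k)"
  shows "linear_growth (\<lambda>n ps. \<Sum>k\<in>I. Y k n ps) (\<Sum>k\<in>I. y k)"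
  using assms
proof (induction I rule: finite_induct)
  case empty
  show ?case using linear_growth_size[of 0] by simp
next
  case (insert k I)
  then show ?case using linear_growth_add[of "Y k" "y k" "\<lambda>n ps. \<Sum>k\<in>I. Y k n ps" "\<Sum>k\<in>I. y k"] by simp
qed

text \<open>The value \<open>y\<close> is forced by \<open>y = b + (w - a y) / 2\<close>. With this choice the error \<open>Y - y n\<close> has drift
  \<open>(G - a (Y - y n)) / (2 (n - 1))\<close> with \<open>G = W - w n + w - a y\<close>, so its second moment grows at most linearly.\<close>

theorem linear_growth_recursion:
  assumes inc: "\<And>n ps i. n \<ge> 2 \<Longrightarrow> tree_code n ps \<Longrightarrow> i < n \<Longrightarrow> \<bar>Y (Suc n) (ps @ [i]) - Y n ps\<bar> \<le> B"
    and drift: "\<And>n ps. n \<ge> 2 \<Longrightarrow> tree_code n ps \<Longrightarrow>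
      (\<Sum>i<n. attach_prob n ps i * (Y (Suc n) (ps @ [i]) - Y n ps)) = b + (W n ps - a * Y n ps) / (2 * (real n - 1))"
    and W: "linear_growth W w" and a: "a \<ge> 0"
  shows "linear_growth Y ((2 * b + w) / (2 + a))"
proof -
  define y where "y = (2 * b + w) / (2 + a)"
  have "(2 + a) * y = 2 * b + w" using a by (simp add: y_def)
  then have y: "2 * y + a * y = 2 * b + w" by (simp add: distrib_right)
  obtain C :: real where C: "C \<ge> 0" "\<And>n. n \<ge> 2 \<Longrightarrow> expect n (\<lambda>ps. (W n ps - w * n)\<^sup>2) \<le> C * n"
    using W unfolding linear_growth_def by metis
  define e where "e n ps = Y n ps - y * real n" for n ps
  define k where "k = w - a * y"
  define D where "D = B + \<bar>y\<bar>"
  \<comment> \<open>Collects all that does not multiply the old second moment: \<open>4 * C\<close>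
    and \<open>2 * k\<^sup>2\<close> from the drift, by \<open>s * n \<le> 1\<close> and
    \<open>s \<le> 1 / 2\<close>, and \<open>D\<^sup>2\<close> from the squared increment.\<close>
  define R where "R = 4 * C + 2 * k\<^sup>2 + D\<^sup>2"
  have rec: "expect (Suc n) (\<lambda>ps. (e (Suc n) ps)\<^sup>2) \<le> expect n (\<lambda>ps. (e n ps)\<^sup>2) * (1 + 1 / (4 * (real n - 1))) + R"
    if n: "n \<ge> 2" for n
  proof -
    define s where "s = 1 / (2 * (real n - 1))"
    have s: "0 \<le> s" "s * n \<le> 1" "s \<le> 1 / 2" using n by (auto simp: s_def field_simps)
    have "expect (Suc n) (\<lambda>ps. (e (Suc n) ps)\<^sup>2) =
        expect n (\<lambda>ps. \<Sum>i<n. attach_prob n ps i * (e (Suc n) (ps @ [i]))\<^sup>2)"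
      by (rule expect_Suc[OF n])
    also have "\<dots> \<le> expect n (\<lambda>ps. (1 + s / 2) * (e n ps)\<^sup>2 + (4 * s) * (W n ps - w * n)\<^sup>2 + (4 * s * k\<^sup>2 + D\<^sup>2))"
    proof (rule expect_mono[OF n])
      fix ps assume tc: "tree_code n ps"
      define q where "q = attach_prob n ps"
      have q: "\<And>i. q i \<ge> 0" "(\<Sum>i<n. q i) = 1"
        using attach_prob_nonneg[OF n] sum_attach_prob[OF n tc] by (auto simp: q_def)
      define \<delta> where "\<delta> i = Y (Suc n) (ps @ [i]) - Y n ps - y" for i
      have \<delta>: "(\<delta> i)\<^sup>2 \<le> D\<^sup>2" if "i < n" for i
      proof -
        have "\<bar>\<delta> i\<bar> \<le> D" using inc[OF n tc that] by (auto simp: \<delta>_def D_def)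
        then show ?thesis by (metis abs_ge_zero power2_abs power_mono)
      qed
      define G where "G = (W n ps - w * n) + k"
      have "(\<Sum>i<n. q i * \<delta> i) = (\<Sum>i<n. q i * (Y (Suc n) (ps @ [i]) - Y n ps)) - y * (\<Sum>i<n. q i)"
        by (simp add: \<delta>_def right_diff_distrib sum_subtractf sum_distrib_left mult.commute)
      also have "\<dots> = b - y + s * (W n ps - a * Y n ps)"
        using drift[OF n tc] q(2) by (simp add: q_def s_def)
      also have "\<dots> = s * (G - a * e n ps)"
      proof -
        \<comment> \<open>The equation defining \<open>y\<close> enters here: it lets the constant
          part \<open>b - y\<close> of the drift cancel against the terms linear in
          \<open>n\<close>.\<close>
        have ay: "a * y - w = 2 * (b - y)" using y by (simp add: algebra_simps)
        have "s * (2 * (real n - 1)) * (b - y) = b - y" using n by (simp add: s_def)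
        then have "b - y = s * ((real n - 1) * (a * y - w))"
          unfolding ay by (simp only: mult_ac)
        then show ?thesis by (simp add: G_def k_def e_def algebra_simps)
      qed
      finally have qd: "(\<Sum>i<n. q i * \<delta> i) = s * (G - a * e n ps)" .
      have "(\<Sum>i<n. q i * (e (Suc n) (ps @ [i]))\<^sup>2) =
          (\<Sum>i<n. q i * (e n ps)\<^sup>2 + 2 * e n ps * (q i * \<delta> i) + q i * (\<delta> i)\<^sup>2)"
        by (intro sum.cong refl) (simp add: e_def \<delta>_def power2_eq_square algebra_simps)
      also have "\<dots> = (e n ps)\<^sup>2 + 2 * e n ps * (\<Sum>i<n. q i * \<delta> i) + (\<Sum>i<n. q i * (\<delta> i)\<^sup>2)"
        by (simp add: sum.distrib sum_distrib_left[symmetric] sum_distrib_right[symmetric] q(2))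
      also have "(\<Sum>i<n. q i * (\<delta> i)\<^sup>2) \<le> (\<Sum>i<n. q i * D\<^sup>2)"
        by (intro sum_mono mult_left_mono q) (auto simp: \<delta>)
      also have "(\<Sum>i<n. q i * D\<^sup>2) = D\<^sup>2" by (simp add: sum_distrib_right[symmetric] q(2))
      also have "2 * e n ps * (\<Sum>i<n. q i * \<delta> i) \<le> s * ((e n ps)\<^sup>2 / 2 + 2 * G\<^sup>2)"
      proof -
        \<comment> \<open>Weighted so that the old square is inflated only by \<open>s / 2\<close>,
          small enough for linear growth. The contribution of \<open>- a * e n ps\<close> is
          nonpositive and is dropped.\<close>
        have "0 \<le> (e n ps / 2 - G)\<^sup>2" by simp
        then have "2 * e n ps * G \<le> (e n ps)\<^sup>2 / 2 + 2 * G\<^sup>2"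
          by (simp add: power2_eq_square algebra_simps)
        moreover have "2 * e n ps * (G - a * e n ps) \<le> 2 * e n ps * G"
          using a by (simp add: algebra_simps)
        ultimately have "2 * e n ps * (G - a * e n ps) \<le> (e n ps)\<^sup>2 / 2 + 2 * G\<^sup>2" by linarith
        then have "s * (2 * e n ps * (G - a * e n ps)) \<le> s * ((e n ps)\<^sup>2 / 2 + 2 * G\<^sup>2)"
          using s(1) by (rule mult_left_mono)
        then show ?thesis unfolding qd by (simp only: mult_ac)
      qed
      also have "s * ((e n ps)\<^sup>2 / 2 + 2 * G\<^sup>2) \<le> s * ((e n ps)\<^sup>2 / 2 + 2 * (2 * (W n ps - w * n)\<^sup>2 + 2 * k\<^sup>2))"
        unfolding G_def by (intro mult_left_mono add_left_mono sum_sq_le s) simp_all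
      finally show "(\<Sum>i<n. attach_prob n ps i * (e (Suc n) (ps @ [i]))\<^sup>2) \<le>
          (1 + s / 2) * (e n ps)\<^sup>2 + (4 * s) * (W n ps - w * n)\<^sup>2 + (4 * s * k\<^sup>2 + D\<^sup>2)"
        by (simp add: q_def algebra_simps)
    qed
    also have "\<dots> = (1 + s / 2) * expect n (\<lambda>ps. (e n ps)\<^sup>2) + (4 * s) * expect n (\<lambda>ps. (W n ps - w * n)\<^sup>2) + (4 * s * k\<^sup>2 + D\<^sup>2)"
      using n by simp
    also have "\<dots> \<le> (1 + s / 2) * expect n (\<lambda>ps. (e n ps)\<^sup>2) + 4 * C + (2 * k\<^sup>2 + D\<^sup>2)"
    proof -
      have "4 * s * expect n (\<lambda>ps. (W n ps - w * n)\<^sup>2) \<le> 4 * s * (C * n)"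
        using s(1) by (intro mult_left_mono C n) auto
      also have "\<dots> = 4 * C * (s * n)" by simp
      also have "\<dots> \<le> 4 * C * 1" using C(1) s(2) by (intro mult_left_mono) auto
      finally have "4 * s * expect n (\<lambda>ps. (W n ps - w * n)\<^sup>2) \<le> 4 * C" by simp
      moreover have "4 * s * k\<^sup>2 \<le> 2 * k\<^sup>2" using s(3) by (intro mult_right_mono) auto
      ultimately show ?thesis by linarith
    qed
    finally have *: "expect (Suc n) (\<lambda>ps. (e (Suc n) ps)\<^sup>2) \<le>
        (1 + s / 2) * expect n (\<lambda>ps. (e n ps)\<^sup>2) + 4 * C + (2 * k\<^sup>2 + D\<^sup>2)" .
    have "s / 2 = 1 / (4 * (real n - 1))" by (simp add: s_def)
    with * show ?thesis by (simp only: R_def mult.commute[of "1 + _"] add.assoc)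
  qed
  \<comment> \<open>In the induction \<open>n / (4 * (n - 1)) \<le> 1 / 2\<close> and
    \<open>R \<le> K / 2\<close>, so one step adds at most \<open>K\<close>; the second argument
    covers the start at 2.\<close>
  define K where "K = max (2 * R) (expect 2 (\<lambda>ps. (e 2 ps)\<^sup>2))"
  have "R \<ge> 0" using C(1) by (simp add: R_def)
  then have K: "K \<ge> 0" "K \<ge> 2 * R" by (auto simp: K_def)
  have "expect n (\<lambda>ps. (e n ps)\<^sup>2) \<le> K * n" if "n \<ge> 2" for n
    using that
  proof (induction n rule: dec_induct)
    case base
    show ?case using K by (auto simp: K_def)
  next
    case (step n)
    have "expect (Suc n) (\<lambda>ps. (e (Suc n) ps)\<^sup>2) \<le> expect n (\<lambda>ps. (e n ps)\<^sup>2) * (1 + 1 / (4 * (real n - 1))) + R"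
      by (rule rec[OF step.hyps(1)])
    also have "\<dots> \<le> K * n * (1 + 1 / (4 * (real n - 1))) + R"
      using step.hyps by (intro add_right_mono mult_right_mono step.IH) auto
    also have "\<dots> = K * n + K * (n / (4 * (real n - 1))) + R" by (simp add: algebra_simps)
    also have "\<dots> \<le> K * n + K * (1 / 2) + R"
      using step.hyps K by (intro add_mono mult_left_mono order.refl) (auto simp: field_simps)
    also have "\<dots> \<le> K * Suc n" using K by (simp add: algebra_simps)
    finally show ?case .
  qed
  then show ?thesis using K unfolding linear_growth_def y_def[symmetric] e_def by blast
qed

subsection \<open>Vertices by number of children and pendant paths\<close>

text \<open>The root is left out so that every vertex counted has degree exactly
  \<open>k + 1\<close>; its share of the energy is estimated separately.\<close>

definition with_children :: "nat \<Rightarrow> nat \<Rightarrow> nat list \<Rightarrow> nat set" where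
  "with_children k n ps = {v \<in> {1..<n}. nchild n ps v = k}"

lemma finite_with_children [simp]: "finite (with_children k n ps)"
  by (simp add: with_children_def)

lemma children_append:
  assumes "tree_code n ps" "n \<ge> 1"
  shows "children (Suc n) (ps @ [i]) v = children n ps v \<union> (if v = i then {n} else {})"
  using parent_append[OF assms(1)] assms(2)
  by (auto simp: children_def less_Suc_eq)

lemma nchild_append:
  assumes "tree_code n ps" "n \<ge> 1"
  shows "nchild (Suc n) (ps @ [i]) v = nchild n ps v + (if v = i then 1 else 0)"
  unfolding children_append[OF assms] by (auto simp: children_def)

lemma children_outside:
  assumes "tree_code n ps" "v \<ge> n"
  shows "children n ps v = {}"
  using tree_code_parent_less[OF assms(1)] assms(2) by (fastforce simp: children_def)

lemma attach_prob_nonroot: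
  assumes "i \<in> {1..<n}"
  shows "attach_prob n ps i = (real (nchild n ps i) + 1) / (2 * (real n - 1))"
  using assms by (simp add: attach_prob_def tdeg_eq)

text \<open>The new vertex enters class 0 and a nonroot host moves up by one class; a root host
  changes no class.\<close>

lemma card_with_children_append:
  assumes tc: "tree_code n ps" and n: "n \<ge> 2" and i: "i < n"
  shows "real (card (with_children k (Suc n) (ps @ [i]))) - card (with_children k n ps) =
    of_bool (k = 0) + (if i \<in> {1..<n} then of_bool (nchild n ps i + 1 = k) - of_bool (nchild n ps i = k) else 0)"
proof -
  have card_eq: "real (card {v \<in> A. P v}) = (\<Sum>v\<in>A. of_bool (P v))" if "finite A" for A :: "nat set" and P
    using that by (simp add: Int_def)
  have nc: "nchild (Suc n) (ps @ [i]) v = nchild n ps v + (if v = i then 1 else 0)" for v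
    using nchild_append[OF tc] n by auto
  have "real (card (with_children k (Suc n) (ps @ [i]))) =
      (\<Sum>v\<in>{1..<Suc n}. of_bool (nchild n ps v + (if v = i then 1 else 0) = k))"
    unfolding with_children_def nc by (rule card_eq) simp
  also have "\<dots> = of_bool (k = 0) + (\<Sum>v\<in>{1..<n}. of_bool (nchild n ps v + (if v = i then 1 else 0) = k))"
    using n i children_outside[OF tc, of n] by (subst sum.atLeastLessThan_Suc) auto
  finally have "real (card (with_children k (Suc n) (ps @ [i]))) - card (with_children k n ps) =
      of_bool (k = 0) + (\<Sum>v\<in>{1..<n}. of_bool (nchild n ps v + (if v = i then 1 else 0) = k) - of_bool (nchild n ps v = k))"
    unfolding with_children_def by (simp only: card_eq[OF finite_atLeastLessThan] sum_subtractf)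
  also have "(\<Sum>v\<in>{1..<n}. of_bool (nchild n ps v + (if v = i then 1 else 0) = k) - of_bool (nchild n ps v = k)) =
      (\<Sum>v\<in>{1..<n}. if i = v then of_bool (nchild n ps v + 1 = k) - of_bool (nchild n ps v = k) else (0::real))"
    by (intro sum.cong) auto
  also have "\<dots> = (if i \<in> {1..<n} then of_bool (nchild n ps i + 1 = k) - of_bool (nchild n ps i = k) else 0)"
    by (rule sum.delta') simp
  finally show ?thesis .
qed

text \<open>A nonroot vertex with \<open>c\<close> children is hit with weight \<open>c + 1\<close>,
  so class \<open>k\<close> gains at rate \<open>k\<close> from the class below and loses at rate
  \<open>k + 1\<close>. For \<open>k = 0\<close> the truncated \<open>k - 1\<close> is harmless
  because of the factor \<open>k\<close>.\<close>

lemma with_children_drift: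
  assumes n: "n \<ge> 2" and tc: "tree_code n ps"
  shows "(\<Sum>i<n. attach_prob n ps i * (real (card (with_children k (Suc n) (ps @ [i]))) - card (with_children k n ps))) =
    of_bool (k = 0) + (k * card (with_children (k - 1) n ps) - (real k + 1) * card (with_children k n ps)) / (2 * (real n - 1))"
proof -
  let ?c = "nchild n ps"
  have card_eq: "real (card (with_children k n ps)) = (\<Sum>v\<in>{1..<n}. of_bool (?c v = k))" for k
    by (simp add: with_children_def Int_def)
  have "(\<Sum>i<n. attach_prob n ps i * (real (card (with_children k (Suc n) (ps @ [i]))) - card (with_children k n ps))) =
    (\<Sum>i<n. attach_prob n ps i * of_bool (k = 0) +
      (if i \<in> {1..<n} then attach_prob n ps i * (of_bool (?c i + 1 = k) - of_bool (?c i = k)) else 0))"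
    by (intro sum.cong refl) (simp add: card_with_children_append[OF tc n] distrib_left)
  also have "\<dots> = of_bool (k = 0) * (\<Sum>i<n. attach_prob n ps i) +
      (\<Sum>i<n. if i \<in> {1..<n} then attach_prob n ps i * (of_bool (?c i + 1 = k) - of_bool (?c i = k)) else 0)"
    by (simp add: sum.distrib sum_distrib_left mult.commute)
  also have "(\<Sum>i<n. if i \<in> {1..<n} then attach_prob n ps i * (of_bool (?c i + 1 = k) - of_bool (?c i = k)) else 0) =
      (\<Sum>i\<in>{1..<n}. attach_prob n ps i * (of_bool (?c i + 1 = k) - of_bool (?c i = k)))"
    by (subst sum.inter_restrict[symmetric]) (auto intro!: sum.cong)
  also have "\<dots> = (\<Sum>i\<in>{1..<n}. (real k * of_bool (?c i + 1 = k) - (real k + 1) * of_bool (?c i = k)) / (2 * (real n - 1)))"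
    by (intro sum.cong refl) (auto simp: attach_prob_nonroot)
  also have "\<dots> = (real k * (\<Sum>i\<in>{1..<n}. of_bool (?c i + 1 = k)) - (real k + 1) * (\<Sum>i\<in>{1..<n}. of_bool (?c i = k))) / (2 * (real n - 1))"
    by (simp only: sum_divide_distrib[symmetric] sum_subtractf sum_distrib_left)
  also have "real k * (\<Sum>i\<in>{1..<n}. of_bool (?c i + 1 = k)) = k * card (with_children (k - 1) n ps)"
  proof (cases k)
    case (Suc m)
    have "(\<Sum>i\<in>{1..<n}. of_bool (?c i + 1 = k)) = real (card (with_children (k - 1) n ps))"
      unfolding card_eq by (intro sum.cong) (auto simp: Suc)
    then show ?thesis by simp
  qed simp
  finally show ?thesis by (simp add: sum_attach_prob[OF n tc] card_eq)
qed

text \<open>The recursion theorem gives density \<open>2 / 3\<close> for leaves and then the ratio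
  \<open>(k + 1) / (k + 4)\<close> between consecutive classes, which telescopes to the stated
  formula.\<close>

lemma with_children_growth:
  "linear_growth (\<lambda>n ps. card (with_children k n ps)) (4 / ((real k + 1) * (real k + 2) * (real k + 3)))"
proof (induction k)
  case 0
  have "linear_growth (\<lambda>n ps. card (with_children 0 n ps)) ((2 * 1 + 0) / (2 + 1))"
  proof (rule linear_growth_recursion[where B = 2 and W = "\<lambda>n ps. 0"])
    show "linear_growth (\<lambda>n ps. 0) 0" using linear_growth_size[of 0] by simp
  qed (use with_children_drift[of _ _ 0] card_with_children_append[of _ _ _ 0] in auto)
  then show ?case by simp
next
  case (Suc k)
  define W where "W n ps = real (Suc k) * card (with_children k n ps)" for n ps
  define w where "w = real (Suc k) * (4 / ((real k + 1) * (real k + 2) * (real k + 3)))"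
  have "linear_growth (\<lambda>n ps. card (with_children (Suc k) n ps)) ((2 * 0 + w) / (2 + (real (Suc k) + 1)))"
  proof (rule linear_growth_recursion[where B = 2 and W = W])
    show "linear_growth W w" unfolding W_def w_def by (intro linear_growth_cmult Suc)
  qed (use with_children_drift[of _ _ "Suc k"] card_with_children_append[of _ _ _ "Suc k"] in \<open>auto simp: W_def distrib_right\<close>)
  moreover have "(2 * 0 + w) / (2 + (real (Suc k) + 1)) = 4 / ((real (Suc k) + 1) * (real (Suc k) + 2) * (real (Suc k) + 3))"
  proof -
    have "w = ((real k + 1) * 4) / ((real k + 1) * ((real k + 2) * (real k + 3)))"
      by (simp add: w_def mult.assoc add.commute)
    also have "\<dots> = 4 / ((real k + 2) * (real k + 3))" by (rule mult_divide_mult_cancel_left) simp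
    finally have "w = 4 / ((real k + 2) * (real k + 3))" .
    moreover have "2 + (real (Suc k) + 1) = real k + 4" "real (Suc k) + 1 = real k + 2"
      "real (Suc k) + 2 = real k + 3" "real (Suc k) + 3 = real k + 4" by simp_all
    ultimately show ?thesis by (simp only: mult_zero_right add_0 divide_divide_eq_left)
  qed
  ultimately show ?case by simp
qed

section \<open>Limiting densities of pendant paths\<close>

lemma card_prune_append:
  fixes S S' :: "nat set"
  assumes "finite S" "S \<subseteq> {..<n}" "S' = {x \<in> S. i \<notin> N x} \<union> (if i \<in> R then {n} else {})"
  shows "real (card S') - card S = of_bool (i \<in> R) - (\<Sum>x\<in>S. of_bool (i \<in> N x))"
proof -
  have "n \<notin> S" using assms(2) by auto
  have "card S = card {x \<in> S. i \<notin> N x} + card {x \<in> S. i \<in> N x}"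
    using assms(1) by (subst card_Un_disjoint[symmetric]) (auto intro!: arg_cong[of _ _ card])
  moreover have "card S' = card {x \<in> S. i \<notin> N x} + (if i \<in> R then 1 else 0)"
    unfolding assms(3) using assms(1) \<open>n \<notin> S\<close> by (subst card_Un_disjoint) auto
  moreover have "(\<Sum>x\<in>S. of_bool (i \<in> N x)) = real (card {x \<in> S. i \<in> N x})"
    using assms(1) by (simp add: Int_def)
  ultimately show ?thesis by simp
qed

text \<open>Common scheme for both path counts. Attaching inside \<open>N ps x\<close> destroys the
  path with leaf \<open>x\<close>, and these sets have total degree \<open>a\<close>; attaching to a
  nonroot leaf in \<open>R\<close>, of degree 1, creates a path ending in the new vertex.
  Disjointness of the sets means that a step destroys at most one path, so increments are
  bounded.\<close>

lemma prune_growth: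
  assumes fin: "\<And>n ps. finite (S n ps)" and sub: "\<And>n ps. S n ps \<subseteq> {..<n}"
    and R: "\<And>n ps. R n ps \<subseteq> {x \<in> {1..<n}. nchild n ps x = 0}"
    and N: "\<And>n ps x. n \<ge> 2 \<Longrightarrow> tree_code n ps \<Longrightarrow> x \<in> S n ps \<Longrightarrow> N ps x \<subseteq> {..<n}"
    and deg: "\<And>n ps x. n \<ge> 2 \<Longrightarrow> tree_code n ps \<Longrightarrow> x \<in> S n ps \<Longrightarrow> (\<Sum>i\<in>N ps x. real (tdeg n ps i)) = a"
    and disj: "\<And>n ps x y i. n \<ge> 2 \<Longrightarrow> tree_code n ps \<Longrightarrow> x \<in> S n ps \<Longrightarrow> y \<in> S n ps \<Longrightarrow>
      i \<in> N ps x \<Longrightarrow> i \<in> N ps y \<Longrightarrow> x = y"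
    and append: "\<And>n ps i. n \<ge> 2 \<Longrightarrow> tree_code n ps \<Longrightarrow> i < n \<Longrightarrow>
      S (Suc n) (ps @ [i]) = {x \<in> S n ps. i \<notin> N ps x} \<union> (if i \<in> R n ps then {n} else {})"
    and growth: "linear_growth (\<lambda>n ps. card (R n ps)) w" and a: "a \<ge> 0"
  shows "linear_growth (\<lambda>n ps. card (S n ps)) (w / (2 + a))"
proof -
  note diff = card_prune_append[OF fin sub append]
  have "linear_growth (\<lambda>n ps. card (S n ps)) ((2 * 0 + w) / (2 + a))"
  proof (rule linear_growth_recursion[where B = 2 and W = "\<lambda>n ps. real (card (R n ps))"])
    fix n ps i assume n: "n \<ge> (2::nat)" and tc: "tree_code n ps" and i: "i < n"
    have "card {x \<in> S n ps. i \<in> N ps x} \<le> Suc 0"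
      using disj[OF n tc] fin by (subst card_le_Suc0_iff_eq) auto
    moreover have "(\<Sum>x\<in>S n ps. of_bool (i \<in> N ps x)) = real (card {x \<in> S n ps. i \<in> N ps x})"
      using fin by (simp add: Int_def)
    ultimately show "\<bar>real (card (S (Suc n) (ps @ [i]))) - real (card (S n ps))\<bar> \<le> 2"
      unfolding diff[OF n tc i] by auto
  next
    fix n ps assume n: "n \<ge> (2::nat)" and tc: "tree_code n ps"
    let ?q = "attach_prob n ps"
    have "(\<Sum>i<n. ?q i * (real (card (S (Suc n) (ps @ [i]))) - real (card (S n ps)))) =
        (\<Sum>i<n. ?q i * of_bool (i \<in> R n ps)) - (\<Sum>i<n. \<Sum>x\<in>S n ps. ?q i * of_bool (i \<in> N ps x))"
      unfolding sum_subtractf[symmetric]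
      by (intro sum.cong refl) (simp add: diff[OF n tc] right_diff_distrib sum_distrib_left)
    also have "(\<Sum>i<n. ?q i * of_bool (i \<in> R n ps)) = (\<Sum>i\<in>R n ps. ?q i)"
      using R[of n ps] by (intro sum.mono_neutral_cong_right) auto
    also have "\<dots> = (\<Sum>i\<in>R n ps. 1 / (2 * (real n - 1)))"
      using R[of n ps] by (intro sum.cong refl) (subst attach_prob_nonroot, auto)
    also have "(\<Sum>i<n. \<Sum>x\<in>S n ps. ?q i * of_bool (i \<in> N ps x)) = (\<Sum>x\<in>S n ps. \<Sum>i<n. ?q i * of_bool (i \<in> N ps x))"
      by (rule sum.swap)
    also have "\<dots> = (\<Sum>x\<in>S n ps. a / (2 * (real n - 1)))"
    proof (intro sum.cong refl)
      fix x assume x: "x \<in> S n ps"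
      have "(\<Sum>i<n. ?q i * of_bool (i \<in> N ps x)) = (\<Sum>i\<in>N ps x. ?q i)"
        using N[OF n tc x] by (intro sum.mono_neutral_cong_right) auto
      also have "\<dots> = a / (2 * (real n - 1))"
        unfolding attach_prob_def sum_divide_distrib[symmetric] deg[OF n tc x] ..
      finally show "(\<Sum>i<n. ?q i * of_bool (i \<in> N ps x)) = a / (2 * (real n - 1))" .
    qed
    finally show "(\<Sum>i<n. ?q i * (real (card (S (Suc n) (ps @ [i]))) - real (card (S n ps)))) =
        0 + (real (card (R n ps)) - a * real (card (S n ps))) / (2 * (real n - 1))"
      by (simp add: diff_divide_distrib mult.commute)
  qed (use growth a in auto)
  then show ?thesis by simp
qed

lemma nchild_parent_pos:
  assumes "x \<in> {1..<n}"
  shows "nchild n ps (parent ps x) \<noteq> 0"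
  using assms by (auto simp: children_def)

text \<open>Attaching to the leaf \<open>x\<close> itself also counts as destroying its path: the
  path ending in the new vertex is booked as a creation.\<close>

lemma pendant2_append:
  assumes n: "n \<ge> 2" and tc: "tree_code n ps" and i: "i < n"
  shows "pendant2 (Suc n) (ps @ [i]) =
    {x \<in> pendant2 n ps. i \<notin> {x, parent ps x}} \<union> (if i \<in> with_children 0 n ps then {n} else {})"
proof -
  have nc: "nchild (Suc n) (ps @ [i]) v = nchild n ps v + (if v = i then 1 else 0)" for v
    using nchild_append[OF tc] n by auto
  have "x \<in> pendant2 (Suc n) (ps @ [i]) \<longleftrightarrow> x \<in> pendant2 n ps \<and> i \<notin> {x, parent ps x}" if x: "x \<in> {1..<n}" for x
    \<comment> \<open>No old vertex can enter: the parent of \<open>x\<close> already has a child,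
      so a hit there leaves it with at least two.\<close>
    using x nchild_parent_pos[OF x, of ps] by (auto simp: pendant2_def nc parent_append(1)[OF tc x])
  moreover have "n \<in> pendant2 (Suc n) (ps @ [i]) \<longleftrightarrow> i \<in> with_children 0 n ps"
    using n i parent_append(2)[OF tc] children_outside[OF tc, of n]
    by (auto simp: pendant2_def nc with_children_def)
  moreover have "pendant2 (Suc n) (ps @ [i]) \<subseteq> insert n {1..<n}" "pendant2 n ps \<subseteq> {1..<n}"
    by (auto simp: pendant2_def)
  ultimately show ?thesis by (auto split: if_splits)
qed

lemma pendant3_append:
  assumes n: "n \<ge> 2" and tc: "tree_code n ps" and i: "i < n"
  shows "pendant3 (Suc n) (ps @ [i]) =
    {x \<in> pendant3 n ps. i \<notin> {x, parent ps x, parent ps (parent ps x)}} \<union> (if i \<in> pendant2 n ps then {n} else {})"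
proof -
  let ?p = "parent ps"
  have nc: "nchild (Suc n) (ps @ [i]) v = nchild n ps v + (if v = i then 1 else 0)" for v
    using nchild_append[OF tc] n by auto
  have old: "x \<in> pendant3 (Suc n) (ps @ [i]) \<longleftrightarrow> x \<in> pendant3 n ps \<and> i \<notin> {x, ?p x, ?p (?p x)}"
    if x: "x \<in> {1..<n}" for x
  proof (cases "x \<in> pendant2 n ps")
    case True
    note f = pendant2_facts[OF tc True]
    show ?thesis
      using True x nchild_parent_pos[OF f(2), of ps]
      by (auto simp: pendant3_def pendant2_append[OF n tc i] nc parent_append(1)[OF tc x] parent_append(1)[OF tc f(2)])
  next
    case False
    then show ?thesis using x by (auto simp: pendant3_def pendant2_append[OF n tc i] split: if_splits)
  qed
  have new: "n \<in> pendant3 (Suc n) (ps @ [i]) \<longleftrightarrow> i \<in> pendant2 n ps"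
  proof (cases "i \<in> with_children 0 n ps")
    case True
    then have i': "i \<in> {1..<n}" "nchild n ps i = 0" by (auto simp: with_children_def)
    \<comment> \<open>Hence the child count of \<open>?p i\<close> is not affected by attaching to
      \<open>i\<close>, and the condition on the top vertex is the one in
      \<open>pendant2\<close>.\<close>
    have "?p i \<noteq> i" using tree_code_parent_less[OF tc i'(1)] by simp
    then show ?thesis
      using True i' n parent_append(2)[OF tc]
      by (auto simp: pendant3_def pendant2_append[OF n tc i] nc parent_append(1)[OF tc i'(1)]) (auto simp: pendant2_def)
  next
    case False
    moreover have "n \<notin> pendant2 n ps" by (auto simp: pendant2_def)
    ultimately show ?thesis
      by (auto simp: pendant3_def pendant2_append[OF n tc i]) (auto simp: pendant2_def with_children_def)
  qed
  have "pendant3 (Suc n) (ps @ [i]) \<subseteq> insert n {1..<n}" "pendant3 n ps \<subseteq> {1..<n}"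
    by (auto simp: pendant3_def pendant2_def)
  then show ?thesis using old new by (auto split: if_splits)
qed

text \<open>Paths are created at nonroot leaves, of density \<open>2 / 3\<close>, and have total
  degree \<open>1 + 2 = 3\<close>.\<close>

lemma pendant2_growth: "linear_growth (\<lambda>n ps. card (pendant2 n ps)) (2 / 15)"
proof -
  have "linear_growth (\<lambda>n ps. card (pendant2 n ps)) (2 / 3 / (2 + 3))"
  proof (rule prune_growth[where N = "\<lambda>ps x. {x, parent ps x}" and R = "with_children 0"])
    show "linear_growth (\<lambda>n ps. card (with_children 0 n ps)) (2 / 3)"
      using with_children_growth[of 0] by simp
  next
    fix n ps x assume n: "n \<ge> (2::nat)" and tc: "tree_code n ps" and x: "x \<in> pendant2 n ps"
    note f = pendant2_facts[OF tc x]
    show "{x, parent ps x} \<subseteq> {..<n}" using f by auto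
    show "(\<Sum>i\<in>{x, parent ps x}. real (tdeg n ps i)) = 3" using f by (auto simp: tdeg_eq)
  next
    fix n ps x y i assume "n \<ge> (2::nat)" and tc: "tree_code n ps" and x: "x \<in> pendant2 n ps"
      and y: "y \<in> pendant2 n ps" and i: "i \<in> {x, parent ps x}" "i \<in> {y, parent ps y}"
    show "x = y" using pendant2_facts(3,4)[OF tc x] pendant2_facts(3,4)[OF tc y] i
      by (metis empty_not_insert insertE singletonD singleton_inject)
  qed (simp_all add: pendant2_append, auto simp: pendant2_def with_children_def)
  then show ?thesis by simp
qed

text \<open>Paths are created at the leaves in \<open>pendant2\<close>, of density
  \<open>2 / 15\<close>, and have total degree \<open>1 + 2 + 2 = 5\<close>.\<close>

lemma pendant3_growth: "linear_growth (\<lambda>n ps. card (pendant3 n ps)) (2 / 105)"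
proof -
  have "linear_growth (\<lambda>n ps. card (pendant3 n ps)) (2 / 15 / (2 + 5))"
  proof (rule prune_growth[where N = "\<lambda>ps x. {x, parent ps x, parent ps (parent ps x)}" and R = pendant2])
    fix n ps x assume n: "n \<ge> (2::nat)" and tc: "tree_code n ps" and x: "x \<in> pendant3 n ps"
    note f = pendant3_facts[OF tc x]
    show "{x, parent ps x, parent ps (parent ps x)} \<subseteq> {..<n}" using f by auto
    show "(\<Sum>i\<in>{x, parent ps x, parent ps (parent ps x)}. real (tdeg n ps i)) = 5" using f by (auto simp: tdeg_eq)
  next
    fix n ps x y i assume "n \<ge> (2::nat)" and tc: "tree_code n ps" and x: "x \<in> pendant3 n ps"
      and y: "y \<in> pendant3 n ps" and i: "i \<in> {x, parent ps x, parent ps (parent ps x)}"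
      "i \<in> {y, parent ps y, parent ps (parent ps y)}"
    show "x = y" using pendant3_facts(4,5,6)[OF tc x] pendant3_facts(4,5,6)[OF tc y] i
      by (metis empty_not_insert insertE singletonD singleton_inject)
  qed (simp_all add: pendant3_append pendant2_growth, auto simp: pendant3_def pendant2_def)
  then show ?thesis by simp
qed

subsection \<open>Limiting energy per vertex\<close>

text \<open>The excess of the tangent line \<open>c / t + t\<close> of \<open>2 sqrt c\<close> over \<open>2 sqrt c\<close>. The slope parameter
  \<open>t = 109 / 25\<close> approximates \<open>sqrt 19\<close>, where 19 is the limiting mean of the number of children of a
  vertex with at least 9 children.\<close>

definition tangent_gap :: "nat \<Rightarrow> real" where
  "tangent_gap c = c / (109 / 25) + 109 / 25 - 2 * sqrt c"

lemma tangent_gap_nonneg: "tangent_gap c \<ge> 0"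
proof -
  have "0 \<le> (sqrt c - 109 / 25)\<^sup>2" by simp
  then have "2 * sqrt c * (109 / 25) \<le> c + (109 / 25)\<^sup>2"
    by (simp add: power2_diff)
  then show ?thesis by (simp add: tangent_gap_def power2_eq_square)
qed

text \<open>Square roots are exact for fewer than 9 children and replaced by the tangent line
  otherwise. This leaves a finite linear combination of counts with known growth; writing
  \<open>+ -\<close> matches the closure rules for sums and multiples.\<close>

definition energy_bound :: "nat \<Rightarrow> nat list \<Rightarrow> real" where
  "energy_bound n ps = (25 / 109 + 109 / 25) * n + (\<Sum>k<9. - tangent_gap k * card (with_children k n ps))
    + - (4 - 2 * sqrt 2) * card (pendant3 n ps)"

text \<open>Apart from the root, the star bound is the tangent line summed over vertices minus the
  gaps; nonnegative gaps at 9 or more children are discarded. The root may have very many children,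
  but at most \<open>n\<close>, and costs the lower order term \<open>2 * sqrt n\<close>.\<close>

lemma energy_le_energy_bound:
  assumes tc: "tree_code n ps" and n: "n \<ge> 2"
  shows "energy (adj_matrix n ps) \<le> energy_bound n ps + 2 * sqrt n"
proof -
  let ?c = "nchild n ps"
  have split0: "(\<Sum>v<n. f v) = f 0 + (\<Sum>v\<in>{1..<n}. f v)" for f :: "nat \<Rightarrow> real"
    using n by (simp add: lessThan_atLeast0 sum.atLeast_Suc_lessThan)
  have sumc: "(\<Sum>v<n. real (?c v)) = real n - 1"
    using sum_nchild[OF tc] n by (simp add: of_nat_diff flip: of_nat_sum)
  have "real (?c 0) \<le> n"
    using sumc split0[of "\<lambda>v. real (?c v)"] sum_nonneg[of "{1..<n}" "\<lambda>v. real (?c v)"] by simp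
  have eq: "(\<Sum>v\<in>{1..<n}. 2 * sqrt (?c v)) = (\<Sum>v\<in>{1..<n}. ?c v / (109 / 25) + 109 / 25) - (\<Sum>v\<in>{1..<n}. tangent_gap (?c v))"
    unfolding sum_subtractf[symmetric] tangent_gap_def by simp
  have le: "(\<Sum>v\<in>{1..<n}. ?c v / (109 / 25) + 109 / 25) \<le> (25 / 109 + 109 / 25) * n"
  proof -
    have "(\<Sum>v\<in>{1..<n}. real (?c v)) \<le> n"
      using sumc split0[of "\<lambda>v. real (?c v)"] by simp
    then have *: "25 / 109 * (\<Sum>v\<in>{1..<n}. real (?c v)) \<le> 25 / 109 * real n" by simp
    have "(\<Sum>v\<in>{1..<n}. ?c v / (109 / 25) + 109 / 25) =
        25 / 109 * (\<Sum>v\<in>{1..<n}. real (?c v)) + 109 / 25 * (real n - 1)"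
      using n by (simp add: sum.distrib sum_distrib_left of_nat_diff mult.commute)
    also have "\<dots> \<le> 25 / 109 * real n + 109 / 25 * real n"
      by (intro add_mono * mult_left_mono) auto
    finally show ?thesis by (simp only: distrib_right)
  qed
  have gap: "(\<Sum>k<9. tangent_gap k * card (with_children k n ps)) \<le> (\<Sum>v\<in>{1..<n}. tangent_gap (?c v))"
  proof -
    have "(\<Sum>k<9. tangent_gap k * card (with_children k n ps)) = (\<Sum>k<9. \<Sum>v | v \<in> {v \<in> {1..<n}. ?c v < 9} \<and> ?c v = k. tangent_gap (?c v))"
    proof (intro sum.cong refl)
      fix k :: nat assume "k \<in> {..<9}"
      then have eq: "{v. v \<in> {v \<in> {1..<n}. ?c v < 9} \<and> ?c v = k} = with_children k n ps"
        by (auto simp: with_children_def)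
      show "tangent_gap k * card (with_children k n ps) = (\<Sum>v | v \<in> {v \<in> {1..<n}. ?c v < 9} \<and> ?c v = k. tangent_gap (?c v))"
        unfolding eq by (simp add: with_children_def)
    qed
    also have "\<dots> = (\<Sum>v\<in>{v \<in> {1..<n}. ?c v < 9}. tangent_gap (?c v))"
      by (rule sum.group) auto
    also have "\<dots> \<le> (\<Sum>v\<in>{1..<n}. tangent_gap (?c v))"
      by (intro sum_mono2) (auto simp: tangent_gap_nonneg)
    finally show ?thesis .
  qed
  have "(\<Sum>v\<in>{1..<n}. 2 * sqrt (?c v)) \<le>
      (25 / 109 + 109 / 25) * n - (\<Sum>k<9. tangent_gap k * card (with_children k n ps))"
    unfolding eq by (intro diff_mono le gap)
  moreover have "2 * sqrt (?c 0) \<le> 2 * sqrt n" using \<open>real (?c 0) \<le> n\<close> by simp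
  ultimately show ?thesis
    using energy_le_stars[OF tc] unfolding split0[of "\<lambda>v. 2 * sqrt (?c v)"] energy_bound_def
    by (simp only: mult_minus_left sum_negf)
qed

definition energy_rate :: real where
  "energy_rate = 25 / 109 + 109 / 25 + (\<Sum>k<9. - tangent_gap k * (4 / ((real k + 1) * (real k + 2) * (real k + 3))))
    + - (4 - 2 * sqrt 2) * (2 / 105)"

lemma energy_bound_growth: "linear_growth energy_bound energy_rate"
  unfolding energy_bound_def energy_rate_def
  by (intro linear_growth_add linear_growth_size linear_growth_sum linear_growth_cmult
      with_children_growth pendant3_growth finite_lessThan)

text \<open>The value is about 0.994. All square roots occur with positive coefficients, so rational
  upper bounds suffice.\<close>

lemma energy_rate_less_1: "energy_rate < 1"
proof -
  have le: "sqrt 2 \<le> 141422 / 100000" "sqrt 3 \<le> 173206 / 100000" "sqrt 5 \<le> 223607 / 100000"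
    "sqrt 6 \<le> 244950 / 100000" "sqrt 7 \<le> 264576 / 100000" "sqrt 8 \<le> 282843 / 100000"
    by (rule real_le_lsqrt; simp add: power2_eq_square)+
  have four: "sqrt 4 = (2::real)" using real_sqrt_abs[of 2] by simp
  have set: "{..<9::nat} = {0, 1, 2, 3, 4, 5, 6, 7, 8}" by auto
  show ?thesis
    unfolding energy_rate_def set tangent_gap_def using le by (simp add: four diff_divide_distrib)
qed

section \<open>Chebyshev's inequality and the limit\<close>

theorem theorem1p1:
  shows "(\<lambda>n. measure_pmf.prob (ba_tree n) {ps. hypoenergetic n ps}) \<longlonglongrightarrow> 1"
proof -
  \<comment> \<open>The distance of the rate from 1 is split in two halves: one absorbs the root
    term \<open>2 * sqrt n\<close> for large \<open>n\<close>, the other is the deviation that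
    Chebyshev's inequality excludes.\<close>
  define d where "d = (1 - energy_rate) / 2"
  have d: "d > 0" using energy_rate_less_1 by (simp add: d_def)
  have rate: "energy_rate = 1 - 2 * d" by (simp add: d_def field_simps)
  obtain C where C: "C \<ge> 0"
    "\<And>n. n \<ge> 2 \<Longrightarrow> expect n (\<lambda>ps. (energy_bound n ps - energy_rate * n)\<^sup>2) \<le> C * real n"
    using energy_bound_growth unfolding linear_growth_def by metis
  have "\<forall>\<^sub>F n in sequentially. 2 * sqrt (real n) < d * real n"
    using d by real_asymp
  then have lower: "\<forall>\<^sub>F n in sequentially. 1 - C / d\<^sup>2 / real n \<le> measure_pmf.prob (ba_tree n) {ps. hypoenergetic n ps}"
    using eventually_ge_at_top[of 2]
  proof eventually_elim
    case (elim n)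
    have "1 - measure_pmf.prob (ba_tree n) {ps. hypoenergetic n ps} = measure_pmf.prob (ba_tree n) (- {ps. hypoenergetic n ps})"
      using measure_pmf.prob_compl[of "{ps. hypoenergetic n ps}" "ba_tree n"] by (simp add: Compl_eq_Diff_UNIV)
    also have "\<dots> = expect n (indicator (- {ps. hypoenergetic n ps}))" by simp
    \<comment> \<open>Chebyshev: on a tree that is not hypoenergetic the deviation is at least
      \<open>d * n\<close>, so the quotient dominates the indicator.\<close>
    also have "\<dots> \<le> expect n (\<lambda>ps. (energy_bound n ps - energy_rate * n)\<^sup>2 / (d * n)\<^sup>2)"
    proof (rule expect_mono[OF elim(2)])
      fix ps assume tc: "tree_code n ps"
      show "indicator (- {ps. hypoenergetic n ps}) ps \<le> (energy_bound n ps - energy_rate * n)\<^sup>2 / (d * n)\<^sup>2"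
      proof (cases "hypoenergetic n ps")
        case False
        then have "real n \<le> energy_bound n ps + 2 * sqrt n"
          using energy_le_energy_bound[OF tc elim(2)] by (simp add: hypoenergetic_def)
        moreover have "real n = energy_rate * n + 2 * (d * n)" by (simp add: rate algebra_simps)
        ultimately have "d * n \<le> energy_bound n ps - energy_rate * n" using elim(1) by linarith
        then have "(d * n)\<^sup>2 \<le> (energy_bound n ps - energy_rate * n)\<^sup>2" using d by (intro power_mono) auto
        then show ?thesis using False d elim(2) by (simp add: le_divide_eq_1_pos)
      qed simp
    qed
    also have "\<dots> = expect n (\<lambda>ps. (energy_bound n ps - energy_rate * n)\<^sup>2) / (d * n)\<^sup>2" by simp
    also have "\<dots> \<le> C * n / (d * n)\<^sup>2" by (intro divide_right_mono C elim(2)) simp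
    also have "\<dots> = C / d\<^sup>2 / n" using elim(2) by (simp add: power2_eq_square)
    finally show ?case by simp
  qed
  have "(\<lambda>n. 1 - C / d\<^sup>2 / real n) \<longlonglongrightarrow> 1" by real_asymp
  from tendsto_sandwich[OF lower _ this tendsto_const] show ?thesis by simp
qed

end
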